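(* For each $n\ge1$ let $\pi_n$ be uniformly distributed on $\mathcal{S}_n$, and let $D_n=D(\pi_n)$, $D'_n=D(\pi_n^{-1})$. Then the sequence $(D_n/n,D'_n/n)$ satisfies a large deviation principle on $\mathbb{R}^2$ (with speed $n$) with good rate function $I(x,y)=I(x)+I(y)$, where $I(x)=\sup_{t\in\mathbb{R}}\{xt-L(t)\}$ and $L(t)=\log\big((e^t-1)/t\big)$.
   Context: $\mathcal{S}_n$ is the symmetric group on $\{1,\dots,n\}$; for $\sigma\in\mathcal{S}_n$, $D(\sigma)=\#\{i\le n-1:\sigma(i)>\sigma(i+1)\}$ is the number of descents. $L$ is extended continuously by $L(0)=0$. *)

theory Defs
  imports "HOL-Probability.Probability" "HOL-Combinatorics.Permutations"
begin

definition descents :: "nat \<Rightarrow> (nat \<Rightarrow> nat) \<Rightarrow> nat" where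
  "descents n \<sigma> = card {i \<in> {1..n - 1}. \<sigma> i > \<sigma> (i + 1)}"

(* Logarithm on [0, infinity) with log 0 = -infinity; the library has ln 0 = 0. *)
definition elog :: "real \<Rightarrow> ereal" where
  "elog p = (if p = 0 then -\<infinity> else ereal (ln p))"

definition rate_function :: "('a::topological_space \<Rightarrow> ereal) \<Rightarrow> bool" where
  "rate_function I \<longleftrightarrow> (\<forall>x. 0 \<le> I x) \<and> (\<forall>a::real. closed {x. I x \<le> ereal a})"

definition good_rate_function :: "('a::topological_space \<Rightarrow> ereal) \<Rightarrow> bool" where
  "good_rate_function I \<longleftrightarrow> rate_function I \<and> (\<forall>a::real. compact {x. I x \<le> ereal a})"

(* The \<mu> n are meant to be Borel probability measures for all large n. *)
definition satisfies_LDP ::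
    "(nat \<Rightarrow> 'a::topological_space measure) \<Rightarrow> (nat \<Rightarrow> real) \<Rightarrow> ('a \<Rightarrow> ereal) \<Rightarrow> bool" where
  "satisfies_LDP \<mu> a I \<longleftrightarrow>
     filterlim a at_top sequentially \<and> rate_function I \<and>
     (\<forall>F. closed F \<longrightarrow>
        limsup (\<lambda>n. ereal (1 / a n) * elog (measure (\<mu> n) F)) \<le> - (INF x\<in>F. I x)) \<and>
     (\<forall>G. open G \<longrightarrow>
        - (INF x\<in>G. I x) \<le> liminf (\<lambda>n. ereal (1 / a n) * elog (measure (\<mu> n) G)))"

definition L :: "real \<Rightarrow> real" where
  "L t = (if t = 0 then 0 else ln ((exp t - 1) / t))"

definition rate :: "real \<Rightarrow> ereal" where
  "rate x = (SUP t::real. ereal (x * t - L t))"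

end

theory Submission
  imports Defs "HOL-Real_Asymp.Real_Asymp"
begin

text \<open>
  Write \<open>D\<close> and \<open>D'\<close> for the descent numbers of a permutation and of its inverse. Sorting
  \<open>n\<close> points of an \<open>i \<times> j\<close> grid yields the two-sided Worpitzky identities: the sum over all
  permutations of \<open>C(i + n - 1 - D, n) * C(j + n - 1 - D', n)\<close> is \<open>C(i * j + n - 1, n)\<close>, and
  that of \<open>C(i + n - 1 - D, n) * C(j + D', n)\<close> is \<open>C(i * j, n)\<close>. Multiplying by
  \<open>w ^ i * z ^ j\<close> and summing turns the left-hand sides into the joint moment generating function
  of \<open>(D, D')\<close>. The right-hand sides agree with \<open>(i * j) ^ n / n!\<close> up to shifts of \<open>i\<close> and \<open>j\<close>
  by about \<open>sqrt n\<close>, which are invisible on the exponential scale, so the double series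
  factorises asymptotically and the scaled cumulant generating function tends to \<open>L s + L t\<close>.
  As \<open>L\<close> is differentiable and every point of \<open>(0, 1)\<close> is a value of its derivative, the
  Gaertner-Ellis argument (exponential Chebyshev bounds on half planes for closed sets,
  exponential tilting for open sets) gives the large deviation principle.
\<close>

section \<open>Two-sided Worpitzky identities\<close>

text \<open>The series in w ^ i and z ^ j converge only for w = exp (- s) and z = exp (- t) below 1.
  Summing C(i + n - 1 - D, n) * w ^ i gives w ^ (D + 1) / (1 - w) ^ (n + 1), so the first identity
  reaches only tilts with both parameters negative. Reversing the permutation sends (D, D') to (n -
  1 - D, n - 1 - D') and settles the case of two positive parameters, but opposite signs stay out of
  reach. They are the task of the second identity, whose second factor sums to z ^ (n - D') / (1 -
  z) ^ (n + 1). When a parameter is 0 the series diverge, and the limit is recovered from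
  monotonicity in the parameters and continuity of \<open>L\<close>. The function \<open>L\<close>
  arises from two growth rates: the sum of i ^ n * exp (- s * i) is about n! / s ^ n, and it meets
  the denominator (1 - w) ^ n; the product of n-th powers ((1 - exp (- s)) / s) ^ n is exp (n * L (-
  s)). Only exponential rates matter, so crude Stirling-type bounds are enough.\<close>

definition chains :: "nat \<Rightarrow> nat set \<Rightarrow> nat \<Rightarrow> (nat \<Rightarrow> nat) set" where
  "chains n T i = {a \<in> {1..n} \<rightarrow>\<^sub>E {..<i}.
     \<forall>k\<in>{1..<n}. a k \<le> a (Suc k) \<and> (k \<in> T \<longrightarrow> a k < a (Suc k))}"

lemma finite_chains [simp]: "finite (chains n T i)"
proof -
  have "finite ({1..n} \<rightarrow>\<^sub>E {..<i})" by (intro finite_PiE) auto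
  thus ?thesis unfolding chains_def by simp
qed

lemma chains_mono:
  assumes "a \<in> chains n T i" "1 \<le> k" "k \<le> l" "l \<le> n"
  shows "a k \<le> a l"
  using assms(3,4)
proof (induction l rule: dec_induct)
  case (step m)
  have "m \<in> {1..<n}" using step assms(2) by auto
  then have "a m \<le> a (Suc m)" using assms(1) unfolding chains_def by blast
  thus ?case using step by simp
qed simp

text \<open>By weak monotonicity the last value \<open>c\<close> bounds all earlier ones. A strict
  step at \<open>n\<close> makes \<open>c\<close> itself the exclusive bound, a weak step makes it
  \<open>Suc c\<close>.\<close>

lemma chains_Suc_bij:
  assumes "n \<ge> 1"
  shows "bij_betw (\<lambda>(c, a). a(Suc n := c))
           (SIGMA c:{..<i}. chains n T (if n \<in> T then c else Suc c)) (chains (Suc n) T i)"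
proof (rule bij_betwI[where g = "\<lambda>a. (a (Suc n), a(Suc n := undefined))"])
  show "(\<lambda>(c, a). a(Suc n := c)) \<in>
      (SIGMA c:{..<i}. chains n T (if n \<in> T then c else Suc c)) \<rightarrow> chains (Suc n) T i"
  proof (clarsimp)
    fix c a assume c: "c < i" and a: "a \<in> chains n T (if n \<in> T then c else Suc c)"
    have P: "a \<in> {1..n} \<rightarrow>\<^sub>E {..<(if n \<in> T then c else Suc c)}"
      and Q: "\<And>k. k \<in> {1..<n} \<Longrightarrow> a k \<le> a (Suc k) \<and> (k \<in> T \<longrightarrow> a k < a (Suc k))"
      using a unfolding chains_def by blast+
    have an: "a k < (if n \<in> T then c else Suc c)" if "k \<in> {1..n}" for k
      using P that by (auto simp: PiE_iff)
    have an': "a k < i" if "k \<in> {1..n}" for k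
      using an[OF that] c by (auto split: if_splits)
    have "a(Suc n := c) \<in> {1..Suc n} \<rightarrow>\<^sub>E {..<i}"
      using P c an' by (auto simp: PiE_iff extensional_def)
    moreover have "(a(Suc n := c)) k \<le> (a(Suc n := c)) (Suc k) \<and>
        (k \<in> T \<longrightarrow> (a(Suc n := c)) k < (a(Suc n := c)) (Suc k))" if "k \<in> {1..<Suc n}" for k
      using Q[of k] an[of k] that by (cases "k = n") (auto split: if_splits)
    ultimately show "a(Suc n := c) \<in> chains (Suc n) T i" unfolding chains_def by blast
  qed
  show "(\<lambda>a. (a (Suc n), a(Suc n := undefined))) \<in> chains (Suc n) T i \<rightarrow>
      (SIGMA c:{..<i}. chains n T (if n \<in> T then c else Suc c))"
  proof
    fix a assume a: "a \<in> chains (Suc n) T i"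
    have P: "a \<in> {1..Suc n} \<rightarrow>\<^sub>E {..<i}"
      and Q: "\<And>k. k \<in> {1..<Suc n} \<Longrightarrow> a k \<le> a (Suc k) \<and> (k \<in> T \<longrightarrow> a k < a (Suc k))"
      using a unfolding chains_def by blast+
    have "a k < (if n \<in> T then a (Suc n) else Suc (a (Suc n)))" if "k \<in> {1..n}" for k
    proof -
      have "a k \<le> a n" using chains_mono[OF a] that by simp
      thus ?thesis using Q[of n] assms by auto
    qed
    hence "a(Suc n := undefined) \<in> {1..n} \<rightarrow>\<^sub>E {..<(if n \<in> T then a (Suc n) else Suc (a (Suc n)))}"
      using P by (auto simp: PiE_iff extensional_def)
    moreover have "a (Suc n) < i" using P by (auto simp: PiE_iff)
    ultimately show "(a (Suc n), a(Suc n := undefined)) \<in>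
        (SIGMA c:{..<i}. chains n T (if n \<in> T then c else Suc c))"
      using Q unfolding chains_def by auto
  qed
qed (auto simp: chains_def PiE_iff extensional_def fun_eq_iff)

lemma chains_cong:
  assumes "T \<inter> {1..<n} = T' \<inter> {1..<n}"
  shows "chains n T i = chains n T' i"
  using assms unfolding chains_def by (auto simp: set_eq_iff)

text \<open>Stars and bars: adding to each \<open>a k\<close> the number of non-strict positions
  before \<open>k\<close> gives an \<open>n\<close>-subset of a set of size
  \<open>i + (n - 1 - card T)\<close>. The induction peels off the largest value instead and ends
  with the hockey-stick sum.\<close>

lemma card_chains:
  assumes "n \<ge> 1" "T \<subseteq> {1..<n}"
  shows "card (chains n T i) = (i + (n - 1 - card T)) choose n"
  using assms
proof (induction n arbitrary: T i rule: dec_induct)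
  case base
  hence "chains 1 T i = {1..1} \<rightarrow>\<^sub>E {..<i}" unfolding chains_def by auto
  thus ?case using base by (simp add: card_PiE)
next
  case (step n)
  define T' where "T' = T \<inter> {1..<n}"
  have T'sub: "T' \<subseteq> {1..<n}" by (auto simp: T'_def)
  have cT': "card T' \<le> n - 1" using card_mono[OF _ T'sub] by simp
  have cT: "card T = card T' + (if n \<in> T then 1 else 0)"
  proof -
    have "T = T' \<union> (if n \<in> T then {n} else {})" "n \<notin> T'" "finite T'"
      using step.prems step.hyps by (auto simp: T'_def less_Suc_eq)
    thus ?thesis by (metis (full_types) Un_empty_right Un_insert_right add.commute
        add.right_neutral card_insert_disjoint plus_1_eq_Suc)
  qed
  have "card (chains (Suc n) T i) =
      card (SIGMA c:{..<i}. chains n T (if n \<in> T then c else Suc c))"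
    using bij_betw_same_card[OF chains_Suc_bij[OF step.hyps(1), of i T]] by simp
  also have "\<dots> = (\<Sum>c<i. card (chains n T (if n \<in> T then c else Suc c)))"
    by (simp add: card_SigmaI)
  also have "\<dots> = (\<Sum>c<i. card (chains n T' (if n \<in> T then c else Suc c)))"
    by (intro sum.cong refl arg_cong[where f = card] chains_cong) (auto simp: T'_def)
  also have "\<dots> = (\<Sum>c<i. ((if n \<in> T then c else Suc c) + (n - 1 - card T')) choose n)"
    using step.IH[OF T'sub] by simp
  \<comment> \<open>A strict step at \<open>n\<close> lowers the bound by one but also counts in
    \<open>card T\<close>, so both cases have the same upper index.\<close>
  also have "\<dots> = (\<Sum>c<i. (c + (n - card T)) choose n)"
    using cT cT' step.hyps(1) by (intro sum.cong refl arg_cong2[where f = binomial]) auto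
  also have "\<dots> = (i + (n - card T)) choose Suc n"
    by (induction i) auto
  finally show ?case by simp
qed

section \<open>Standardization of words\<close>

text \<open>Ties in \<open>\<beta>\<close> are broken by \<open>R\<close>; with \<open>R = (<)\<close> this is the order
  in which a stable sort lists the positions.\<close>

definition tie_less :: "(nat \<Rightarrow> nat \<Rightarrow> bool) \<Rightarrow> (nat \<Rightarrow> nat) \<Rightarrow> nat \<Rightarrow> nat \<Rightarrow> bool" where
  "tie_less R \<beta> k l \<longleftrightarrow> \<beta> k < \<beta> l \<or> (\<beta> k = \<beta> l \<and> R k l)"

text \<open>This says that \<open>\<sigma>\<close> is the standardization of the word
  \<open>\<beta>\<close>: \<open>\<sigma> k\<close> is the rank of position \<open>k\<close>, and
  \<open>inv \<sigma>\<close> lists the positions in sorted order.\<close>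

definition orders :: "(nat \<Rightarrow> nat \<Rightarrow> bool) \<Rightarrow> nat \<Rightarrow> (nat \<Rightarrow> nat) \<Rightarrow> (nat \<Rightarrow> nat) \<Rightarrow> bool" where
  "orders R n \<beta> \<sigma> \<longleftrightarrow> (\<forall>k\<in>{1..n}. \<forall>l\<in>{1..n}. \<sigma> k < \<sigma> l \<longleftrightarrow> tie_less R \<beta> k l)"

lemma permutes_rank:
  assumes "\<sigma> permutes {1..n}" "k \<in> {1..n}"
  shows "\<sigma> k = Suc (card {l\<in>{1..n}. \<sigma> l < \<sigma> k})"
proof -
  have "\<sigma> ` {l\<in>{1..n}. \<sigma> l < \<sigma> k} = {l \<in> \<sigma> ` {1..n}. l < \<sigma> k}" by auto
  also have "\<dots> = {1..<\<sigma> k}"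
    using permutes_image[OF assms(1)] permutes_in_image[OF assms(1), of k] assms(2) by auto
  finally have *: "\<sigma> ` {l\<in>{1..n}. \<sigma> l < \<sigma> k} = {1..<\<sigma> k}" .
  have "card {l\<in>{1..n}. \<sigma> l < \<sigma> k} = card {1..<\<sigma> k}"
    unfolding *[symmetric] by (rule card_image[symmetric])
      (meson assms(1) inj_on_subset permutes_inj subset_UNIV)
  moreover have "\<sigma> k \<ge> 1" using permutes_in_image[OF assms(1), of k] assms(2) by simp
  ultimately show ?thesis by simp
qed

lemma orders_unique:
  assumes "\<sigma> permutes {1..n}" "\<rho> permutes {1..n}" "orders R n \<beta> \<sigma>" "orders R n \<beta> \<rho>"
  shows "\<sigma> = \<rho>"
proof
  fix k
  show "\<sigma> k = \<rho> k"
  proof (cases "k \<in> {1..n}")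
    case True
    have "{l\<in>{1..n}. \<sigma> l < \<sigma> k} = {l\<in>{1..n}. \<rho> l < \<rho> k}"
      using assms(3,4) True unfolding orders_def by blast
    thus ?thesis using permutes_rank[OF assms(1) True] permutes_rank[OF assms(2) True] by simp
  next
    case False
    thus ?thesis using assms(1,2) by (simp add: permutes_not_in)
  qed
qed

lemma orders_exists:
  assumes irr: "irreflp R" and tra: "transp R" and tot: "totalp R"
  shows "\<exists>\<sigma>. \<sigma> permutes {1..n} \<and> orders R n \<beta> \<sigma>"
proof -
  define B where "B = (\<lambda>k. {l\<in>{1..n}. tie_less R \<beta> l k})"
  define \<sigma> where "\<sigma> = (\<lambda>k. if k \<in> {1..n} then Suc (card (B k)) else k)"
  have fB: "finite (B k)" for k by (simp add: B_def)
  have tl_irr: "\<not> tie_less R \<beta> k k" for k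
    using irr by (auto simp: tie_less_def irreflp_def)
  have tl_trans: "tie_less R \<beta> k l \<Longrightarrow> tie_less R \<beta> l m \<Longrightarrow> tie_less R \<beta> k m" for k l m
    using tra by (auto simp: tie_less_def transp_def)
  have tl_tot: "k \<noteq> l \<Longrightarrow> tie_less R \<beta> k l \<or> tie_less R \<beta> l k" for k l
    using tot by (auto simp: tie_less_def totalp_on_def)
  have less: "\<sigma> k < \<sigma> l" if "k \<in> {1..n}" "l \<in> {1..n}" "tie_less R \<beta> k l" for k l
  proof -
    have "B k \<subset> B l" using that tl_trans tl_irr unfolding B_def by blast
    thus ?thesis using that psubset_card_mono[OF fB] by (simp add: \<sigma>_def)
  qed
  have ord: "orders R n \<beta> \<sigma>"
    unfolding orders_def using less tl_tot by (metis less_asym less_irrefl)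
  have "inj_on \<sigma> {1..n}"
    by (rule inj_onI) (metis less less_irrefl tl_tot)
  moreover have "\<sigma> ` {1..n} \<subseteq> {1..n}"
  proof clarify
    fix k assume k: "k \<in> {1..n}"
    have "k \<notin> B k" "B k \<subseteq> {1..n}" using tl_irr by (auto simp: B_def)
    hence "B k \<subset> {1..n}" using k by blast
    hence "card (B k) < n" using psubset_card_mono[of "{1..n}" "B k"] by simp
    thus "\<sigma> k \<in> {1..n}" using k by (simp add: \<sigma>_def)
  qed
  ultimately have "bij_betw \<sigma> {1..n} {1..n}"
    by (simp add: bij_betw_def endo_inj_surj)
  hence "\<sigma> permutes {1..n}" by (rule bij_imp_permutes) (auto simp: \<sigma>_def)
  thus ?thesis using ord by blast
qed

text \<open>With \<open>\<beta> = b \<circ> \<sigma>\<close> one has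
  \<open>b m = \<beta> (inv \<sigma> m)\<close>. So \<open>\<sigma>\<close> standardizes
  \<open>\<beta>\<close> exactly when \<open>b\<close> is weakly increasing and is constant only
  across neighbours that \<open>inv \<sigma>\<close> lists in the order \<open>R\<close>.
  Transitivity carries this from neighbours to all pairs.\<close>

lemma chains_comp_permutes_iff:
  assumes irr: "irreflp R" and tra: "transp R" and tot: "totalp R"
    and \<sigma>: "\<sigma> permutes {1..n}" and b: "b \<in> {1..n} \<rightarrow>\<^sub>E {..<j}"
  shows "b \<in> chains n {m. \<not> R (inv \<sigma> m) (inv \<sigma> (Suc m))} j \<longleftrightarrow> orders R n (b \<circ> \<sigma>) \<sigma>"
proof
  assume ch: "b \<in> chains n {m. \<not> R (inv \<sigma> m) (inv \<sigma> (Suc m))} j"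
  have step: "b m \<le> b (Suc m) \<and> (\<not> R (inv \<sigma> m) (inv \<sigma> (Suc m)) \<longrightarrow> b m < b (Suc m))"
    if "m \<in> {1..<n}" for m
    using ch that unfolding chains_def by blast
  have key: "b p < b q \<or> (b p = b q \<and> R (inv \<sigma> p) (inv \<sigma> q))"
    if "1 \<le> p" "Suc p \<le> q" "q \<le> n" for p q
    using that(2,3)
  proof (induction q rule: dec_induct)
    case base
    thus ?case using step[of p] that(1) by auto
  next
    case (step q)
    have "b q < b (Suc q) \<or> (b q = b (Suc q) \<and> R (inv \<sigma> q) (inv \<sigma> (Suc q)))"
      using \<open>\<And>m. m \<in> {1..<n} \<Longrightarrow> _ m\<close>[of q] step that(1) by auto
    moreover have "b p < b q \<or> (b p = b q \<and> R (inv \<sigma> p) (inv \<sigma> q))"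
      using step by simp
    ultimately show ?case
      using transpD[OF tra, of "inv \<sigma> p" "inv \<sigma> q" "inv \<sigma> (Suc q)"] by auto
  qed
  have fwd: "tie_less R (b \<circ> \<sigma>) k l" if "k \<in> {1..n}" "l \<in> {1..n}" "\<sigma> k < \<sigma> l" for k l
    using key[of "\<sigma> k" "\<sigma> l"] permutes_in_image[OF \<sigma>, of k] permutes_in_image[OF \<sigma>, of l] that
    by (simp add: tie_less_def permutes_inverses[OF \<sigma>])
  have "\<sigma> k < \<sigma> l" if "k \<in> {1..n}" "l \<in> {1..n}" "tie_less R (b \<circ> \<sigma>) k l" for k l
  proof (rule ccontr)
    assume "\<not> \<sigma> k < \<sigma> l"
    moreover have "k \<noteq> l" using that(3) irr by (auto simp: tie_less_def irreflp_def)
    hence "\<sigma> k \<noteq> \<sigma> l" using permutes_inj[OF \<sigma>] by (auto dest: injD)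
    ultimately have "tie_less R (b \<circ> \<sigma>) l k" using fwd that by simp
    with that(3) show False
      using irr tra unfolding tie_less_def irreflp_def transp_def
      by (metis less_asym less_irrefl)
  qed
  thus "orders R n (b \<circ> \<sigma>) \<sigma>" using fwd unfolding orders_def by blast
next
  assume ord: "orders R n (b \<circ> \<sigma>) \<sigma>"
  have "b m \<le> b (Suc m) \<and> (\<not> R (inv \<sigma> m) (inv \<sigma> (Suc m)) \<longrightarrow> b m < b (Suc m))"
    if m: "m \<in> {1..<n}" for m
  proof -
    have "inv \<sigma> m \<in> {1..n}" "inv \<sigma> (Suc m) \<in> {1..n}"
      using m permutes_in_image[OF permutes_inv[OF \<sigma>]] by auto
    hence "tie_less R (b \<circ> \<sigma>) (inv \<sigma> m) (inv \<sigma> (Suc m))"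
      using ord[unfolded orders_def, rule_format, of "inv \<sigma> m" "inv \<sigma> (Suc m)"]
      by (simp add: permutes_inverses[OF \<sigma>])
    thus ?thesis by (auto simp: tie_less_def permutes_inverses[OF \<sigma>])
  qed
  thus "b \<in> chains n {m. \<not> R (inv \<sigma> m) (inv \<sigma> (Suc m))} j"
    using b unfolding chains_def by blast
qed

text \<open>Every word is, in exactly one way, a sorted word composed with its standardization. This
  trades a sum over permutations for a sum over all words.\<close>

lemma comp_permutes_bij:
  assumes "irreflp R" "transp R" "totalp R"
  shows "bij_betw (\<lambda>(\<sigma>, b). b \<circ> \<sigma>)
    (SIGMA \<sigma>:{\<sigma>. \<sigma> permutes {1..n}}. chains n {m. \<not> R (inv \<sigma> m) (inv \<sigma> (Suc m))} j)
    ({1..n} \<rightarrow>\<^sub>E {..<j})"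
    (is "bij_betw _ ?X ?Y")
proof -
  have comp: "b \<circ> \<sigma> \<in> ?Y" if "\<sigma> permutes {1..n}" "b \<in> ?Y" for \<sigma> b
    using that(2) permutes_in_image[OF that(1)] by (auto simp: PiE_iff extensional_def)
  have sub: "b \<in> ?Y" if "b \<in> chains n T j" for b T
    using that by (auto simp: chains_def)
  have "inj_on (\<lambda>(\<sigma>, b). b \<circ> \<sigma>) ?X"
  proof (rule inj_onI)
    fix x y assume "x \<in> ?X" "y \<in> ?X" and xy: "(case x of (\<sigma>, b) \<Rightarrow> b \<circ> \<sigma>) = (case y of (\<sigma>, b) \<Rightarrow> b \<circ> \<sigma>)"
    then obtain \<sigma> b \<rho> c where x: "x = (\<sigma>, b)" and y: "y = (\<rho>, c)"
      and \<sigma>: "\<sigma> permutes {1..n}" and b: "b \<in> chains n {m. \<not> R (inv \<sigma> m) (inv \<sigma> (Suc m))} j"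
      and \<rho>: "\<rho> permutes {1..n}" and c: "c \<in> chains n {m. \<not> R (inv \<rho> m) (inv \<rho> (Suc m))} j"
      by blast
    have eq: "b \<circ> \<sigma> = c \<circ> \<rho>" using xy x y by simp
    have "orders R n (b \<circ> \<sigma>) \<sigma>" "orders R n (b \<circ> \<sigma>) \<rho>"
      using chains_comp_permutes_iff[OF assms \<sigma> sub[OF b]] b
        chains_comp_permutes_iff[OF assms \<rho> sub[OF c]] c eq by auto
    hence "\<sigma> = \<rho>" using orders_unique[OF \<sigma> \<rho>] by blast
    moreover have "b = c"
    proof
      fix k show "b k = c k"
        using fun_cong[OF eq, of "inv \<sigma> k"] permutes_inverses(1)[OF \<sigma>, of k] \<open>\<sigma> = \<rho>\<close> by simp
    qed
    ultimately show "x = y" using x y by blast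
  qed
  moreover have "(\<lambda>(\<sigma>, b). b \<circ> \<sigma>) ` ?X = ?Y"
  proof
    show "(\<lambda>(\<sigma>, b). b \<circ> \<sigma>) ` ?X \<subseteq> ?Y"
    proof (rule image_subsetI)
      fix x assume "x \<in> ?X"
      then obtain \<sigma> b where "x = (\<sigma>, b)" "\<sigma> permutes {1..n}"
        "b \<in> chains n {m. \<not> R (inv \<sigma> m) (inv \<sigma> (Suc m))} j"
        by blast
      thus "(case x of (\<sigma>, b) \<Rightarrow> b \<circ> \<sigma>) \<in> ?Y" using comp[of \<sigma> b] sub[of b] by simp
    qed
    show "?Y \<subseteq> (\<lambda>(\<sigma>, b). b \<circ> \<sigma>) ` ?X"
    proof
      fix \<beta> assume \<beta>: "\<beta> \<in> ?Y"
      obtain \<sigma> where \<sigma>: "\<sigma> permutes {1..n}" "orders R n \<beta> \<sigma>"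
        using orders_exists[OF assms] by blast
      define b where "b = \<beta> \<circ> inv \<sigma>"
      have b: "b \<in> ?Y" unfolding b_def by (rule comp[OF permutes_inv[OF \<sigma>(1)] \<beta>])
      have eq: "b \<circ> \<sigma> = \<beta>" by (simp add: b_def fun_eq_iff permutes_inverses[OF \<sigma>(1)])
      have "b \<in> chains n {m. \<not> R (inv \<sigma> m) (inv \<sigma> (Suc m))} j"
        using chains_comp_permutes_iff[OF assms \<sigma>(1) b] eq \<sigma>(2) by simp
      hence "(\<sigma>, b) \<in> ?X" using \<sigma>(1) by simp
      thus "\<beta> \<in> (\<lambda>(\<sigma>, b). b \<circ> \<sigma>) ` ?X" using eq by (auto intro!: rev_image_eqI)
    qed
  qed
  ultimately show ?thesis by (simp add: bij_betw_def)
qed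

section \<open>Grid points in lexicographic order\<close>

lemma lex_less_iff:
  fixes a a' x x' j :: nat
  assumes "x < j" "x' < j"
  shows "a * j + x < a' * j + x' \<longleftrightarrow> a < a' \<or> (a = a' \<and> x < x')"
proof (cases a a' rule: linorder_cases)
  case less
  hence "Suc a * j \<le> a' * j" by (intro mult_le_mono1) simp
  thus ?thesis using less assms by simp
next
  case greater
  hence "Suc a' * j \<le> a * j" by (intro mult_le_mono1) simp
  thus ?thesis using greater assms by simp
qed simp

text \<open>Numbers below \<open>i * j\<close> are read as two digits in base \<open>j\<close>. A
  weak or strict step of the number means that the leading digit \<open>a\<close> rises weakly, and
  strictly wherever the trailing digit \<open>\<beta>\<close> does not rise in the tie
  order.\<close>

lemma lex_chains_bij:
  "bij_betw (\<lambda>(\<beta>, a). \<lambda>k\<in>{1..n}. a k * j + \<beta> k)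
    (SIGMA \<beta>:{1..n} \<rightarrow>\<^sub>E {..<j}. chains n {m. \<not> tie_less R \<beta> m (Suc m)} i)
    (chains n {m. \<not> R m (Suc m)} (i * j))"
    (is "bij_betw ?f ?X ?Y")
proof (rule bij_betwI[where g = "\<lambda>c. (\<lambda>k\<in>{1..n}. c k mod j, \<lambda>k\<in>{1..n}. c k div j)"])
  let ?g = "\<lambda>c. (\<lambda>k\<in>{1..n}. c k mod j, \<lambda>k\<in>{1..n}. c k div j)"
  have step: "(a \<le> a' \<and> (\<not> (x < x' \<or> (x = x' \<and> r)) \<longrightarrow> a < a')) \<longleftrightarrow>
      (a * j + x \<le> a' * j + x' \<and> (\<not> r \<longrightarrow> a * j + x < a' * j + x'))"
    if "x < j" "x' < j" for a a' x x' :: nat and r :: bool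
    using lex_less_iff[OF that, of a a'] lex_less_iff[OF that(2,1), of a' a]
    by (auto simp: not_less[symmetric])
  show "?f \<in> ?X \<rightarrow> ?Y"
  proof (rule Pi_I, unfold split_paired_all, clarsimp)
    fix \<beta> a assume \<beta>: "\<beta> \<in> {Suc 0..n} \<rightarrow>\<^sub>E {..<j}"
      and a: "a \<in> chains n {m. \<not> tie_less R \<beta> m (Suc m)} i"
    have \<beta>j: "\<beta> k < j" if "k \<in> {1..n}" for k using \<beta> that by (auto simp: PiE_iff)
    have ai: "a k < i" if "k \<in> {1..n}" for k using a that by (auto simp: chains_def PiE_iff)
    have "a k * j + \<beta> k < i * j" if "k \<in> {1..n}" for k
      using lex_less_iff[of "\<beta> k" j 0 "a k" i] \<beta>j[OF that] ai[OF that] by simp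
    moreover have "a k * j + \<beta> k \<le> a (Suc k) * j + \<beta> (Suc k) \<and>
        (\<not> R k (Suc k) \<longrightarrow> a k * j + \<beta> k < a (Suc k) * j + \<beta> (Suc k))" if "k \<in> {1..<n}" for k
    proof -
      have "a k \<le> a (Suc k) \<and> (\<not> tie_less R \<beta> k (Suc k) \<longrightarrow> a k < a (Suc k))"
        using a that unfolding chains_def by blast
      thus ?thesis using step[OF \<beta>j[of k] \<beta>j[of "Suc k"]] that unfolding tie_less_def by auto
    qed
    ultimately show "(\<lambda>k\<in>{Suc 0..n}. a k * j + \<beta> k) \<in> ?Y"
      unfolding chains_def by auto
  qed
  show "?g \<in> ?Y \<rightarrow> ?X"
  proof
    fix c assume c: "c \<in> ?Y"
    have cij: "c k < i * j" if "k \<in> {1..n}" for k using c that by (auto simp: chains_def PiE_iff)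
    have j: "j > 0" if "n \<ge> 1" using cij[of 1] that by (cases j) auto
    have cm: "c k mod j < j" if "k \<in> {1..n}" for k using j that by simp
    have ci: "c k div j < i" if "k \<in> {1..n}" for k
      using cij[OF that] by (simp add: less_mult_imp_div_less)
    have "c k div j \<le> c (Suc k) div j \<and>
        (\<not> tie_less R (\<lambda>k\<in>{1..n}. c k mod j) k (Suc k) \<longrightarrow> c k div j < c (Suc k) div j)"
      if "k \<in> {1..<n}" for k
    proof -
      have "c k \<le> c (Suc k) \<and> (\<not> R k (Suc k) \<longrightarrow> c k < c (Suc k))"
        using c that unfolding chains_def by blast
      thus ?thesis
        using step[OF cm[of k] cm[of "Suc k"], of "c k div j" "c (Suc k) div j" "R k (Suc k)"] that
        unfolding tie_less_def by simp
    qed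
    thus "?g c \<in> ?X" using cm ci unfolding chains_def by (auto simp del: One_nat_def)
  qed
  have div: "(a * j + x) div j = a" if "x < j" for a x using that by simp
  show "?g (?f x) = x" if "x \<in> ?X" for x
    using that by (auto simp: chains_def PiE_iff extensional_def fun_eq_iff restrict_def div)
  show "?f (?g c) = c" if "c \<in> ?Y" for c
    using that by (auto simp: chains_def PiE_iff extensional_def fun_eq_iff restrict_def)
qed

text \<open>A two-sided Worpitzky identity; the choices \<open>R = (<)\<close> and \<open>R = (>)\<close> give its
  versions for multisets and for sets of points of the \<open>i \<times> j\<close> grid.\<close>

lemma sum_card_chains_permutes:
  assumes "irreflp R" "transp R" "totalp R"
  shows "(\<Sum>\<sigma> | \<sigma> permutes {1..n}. card (chains n {m. \<sigma> (Suc m) < \<sigma> m} i) *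
      card (chains n {m. \<not> R (inv \<sigma> m) (inv \<sigma> (Suc m))} j)) =
    card (chains n {m. \<not> R m (Suc m)} (i * j))"
proof -
  let ?S = "{\<sigma>. \<sigma> permutes {1..n}}"
  let ?B = "\<lambda>\<sigma>. chains n {m. \<not> R (inv \<sigma> m) (inv \<sigma> (Suc m))} j"
  let ?C = "\<lambda>\<beta>. chains n {m. \<not> tie_less R \<beta> m (Suc m)} i"
  have fin: "finite ?S" by (simp add: finite_permutations)
  \<comment> \<open>Since \<open>\<sigma>\<close> standardizes \<open>b \<circ> \<sigma>\<close>,
    its descents are the places where the word fails to rise in the tie order. The first factor thus
    depends on the word alone.\<close>
  have eq: "chains n {m. \<sigma> (Suc m) < \<sigma> m} i = ?C (b \<circ> \<sigma>)" if \<sigma>: "\<sigma> permutes {1..n}" and b: "b \<in> ?B \<sigma>" for \<sigma> b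
  proof (rule chains_cong)
    have "b \<in> {1..n} \<rightarrow>\<^sub>E {..<j}" using b unfolding chains_def by blast
    hence "orders R n (b \<circ> \<sigma>) \<sigma>" using chains_comp_permutes_iff[OF assms \<sigma>] b by blast
    hence "\<sigma> m < \<sigma> (Suc m) \<longleftrightarrow> tie_less R (b \<circ> \<sigma>) m (Suc m)" if "m \<in> {1..<n}" for m
      using that unfolding orders_def by auto
    moreover have "\<sigma> m \<noteq> \<sigma> (Suc m)" for m
      using permutes_inj[OF \<sigma>] by (metis injD n_not_Suc_n)
    ultimately show "{m. \<sigma> (Suc m) < \<sigma> m} \<inter> {1..<n} =
        {m. \<not> tie_less R (b \<circ> \<sigma>) m (Suc m)} \<inter> {1..<n}"
      by (auto simp: neq_iff) (metis atLeastLessThan_iff less_asym One_nat_def)+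
  qed
  have "(\<Sum>\<sigma>\<in>?S. card (chains n {m. \<sigma> (Suc m) < \<sigma> m} i) * card (?B \<sigma>)) =
      (\<Sum>\<sigma>\<in>?S. \<Sum>b\<in>?B \<sigma>. card (?C (b \<circ> \<sigma>)))"
  proof (intro sum.cong refl)
    fix \<sigma> assume "\<sigma> \<in> ?S"
    hence "(\<Sum>b\<in>?B \<sigma>. card (?C (b \<circ> \<sigma>))) = (\<Sum>b\<in>?B \<sigma>. card (chains n {m. \<sigma> (Suc m) < \<sigma> m} i))"
      using eq[of \<sigma>] by (intro sum.cong refl) simp
    thus "card (chains n {m. \<sigma> (Suc m) < \<sigma> m} i) * card (?B \<sigma>) = (\<Sum>b\<in>?B \<sigma>. card (?C (b \<circ> \<sigma>)))"
      by (simp add: mult.commute)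
  qed
  also have "\<dots> = (\<Sum>x\<in>(SIGMA \<sigma>:?S. ?B \<sigma>). card (?C (case x of (\<sigma>, b) \<Rightarrow> b \<circ> \<sigma>)))"
    using fin by (subst sum.Sigma) (auto simp: case_prod_beta)
  also have "\<dots> = (\<Sum>\<beta>\<in>{1..n} \<rightarrow>\<^sub>E {..<j}. card (?C \<beta>))"
    by (rule sum.reindex_bij_betw[OF comp_permutes_bij[OF assms]])
  also have "\<dots> = card (SIGMA \<beta>:{1..n} \<rightarrow>\<^sub>E {..<j}. ?C \<beta>)"
    by (subst card_SigmaI) (auto intro!: finite_PiE)
  also have "\<dots> = card (chains n {m. \<not> R m (Suc m)} (i * j))"
    by (rule bij_betw_same_card[OF lex_chains_bij])
  finally show ?thesis .
qed

section \<open>The identities in terms of descents\<close>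

lemma descents_altdef: "n \<ge> 1 \<Longrightarrow> descents n \<sigma> = card ({m. \<sigma> (Suc m) < \<sigma> m} \<inter> {1..<n})"
  unfolding descents_def by (intro arg_cong[where f = card]) auto

lemma descents_le: "descents n \<sigma> \<le> n - 1"
proof -
  have "descents n \<sigma> \<le> card {1..n - 1}" unfolding descents_def by (intro card_mono) auto
  thus ?thesis by simp
qed

lemma card_ascents:
  assumes "n \<ge> 1" "inj \<sigma>"
  shows "card ({m. \<sigma> m < \<sigma> (Suc m)} \<inter> {1..<n}) = n - 1 - descents n \<sigma>"
proof -
  let ?D = "{m. \<sigma> (Suc m) < \<sigma> m} \<inter> {1..<n}" and ?A = "{m. \<sigma> m < \<sigma> (Suc m)} \<inter> {1..<n}"
  have "\<sigma> m \<noteq> \<sigma> (Suc m)" for m using assms(2) by (metis injD n_not_Suc_n)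
  hence "{1..<n} = ?A \<union> ?D" by (auto simp: neq_iff)
  moreover have "?A \<inter> ?D = {}" by auto
  ultimately have "card {1..<n} = card ?A + card ?D"
    using card_Un_disjoint[of ?A ?D] by simp
  thus ?thesis using descents_altdef[OF assms(1), of \<sigma>] by simp
qed

lemma card_chains_descents:
  assumes "n \<ge> 1"
  shows "card (chains n {m. \<sigma> (Suc m) < \<sigma> m} i) = (i + (n - 1 - descents n \<sigma>)) choose n"
proof -
  have "chains n {m. \<sigma> (Suc m) < \<sigma> m} i = chains n ({m. \<sigma> (Suc m) < \<sigma> m} \<inter> {1..<n}) i"
    by (rule chains_cong) auto
  thus ?thesis using card_chains[OF assms, of "{m. \<sigma> (Suc m) < \<sigma> m} \<inter> {1..<n}" i]
    by (simp add: descents_altdef[OF assms])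
qed

lemma card_chains_ascents:
  assumes "n \<ge> 1" "inj \<sigma>"
  shows "card (chains n {m. \<sigma> m < \<sigma> (Suc m)} i) = (i + descents n \<sigma>) choose n"
proof -
  have "chains n {m. \<sigma> m < \<sigma> (Suc m)} i = chains n ({m. \<sigma> m < \<sigma> (Suc m)} \<inter> {1..<n}) i"
    by (rule chains_cong) auto
  thus ?thesis using card_chains[OF assms(1), of "{m. \<sigma> m < \<sigma> (Suc m)} \<inter> {1..<n}" i]
      descents_le[of n \<sigma>] card_ascents[OF assms] assms(1) by simp
qed

lemma Worpitzky_multisets:
  assumes "n \<ge> 1"
  shows "(\<Sum>\<sigma> | \<sigma> permutes {1..n}. ((i + (n - 1 - descents n \<sigma>)) choose n) *
      ((j + (n - 1 - descents n (inv \<sigma>))) choose n)) = (i * j + (n - 1)) choose n"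
proof -
  have "(\<Sum>\<sigma> | \<sigma> permutes {1..n}. card (chains n {m. \<sigma> (Suc m) < \<sigma> m} i) *
      card (chains n {m. \<not> inv \<sigma> m < inv \<sigma> (Suc m)} j)) =
    card (chains n {m. \<not> m < Suc m} (i * j))"
    by (rule sum_card_chains_permutes) (auto simp: irreflp_def transp_def totalp_on_def)
  moreover have "{m. \<not> inv \<sigma> m < inv \<sigma> (Suc m)} = {m. inv \<sigma> (Suc m) < inv \<sigma> m}"
    if "\<sigma> permutes {1..n}" for \<sigma>
  proof -
    have "inj (inv \<sigma>)" using permutes_inj[OF permutes_inv[OF that]] .
    hence "inv \<sigma> m \<noteq> inv \<sigma> (Suc m)" for m by (metis injD n_not_Suc_n)
    thus ?thesis by (auto simp: not_less le_less) metis
  qed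
  moreover have "card (chains n {m. \<not> m < Suc m} (i * j)) = (i * j + (n - 1)) choose n"
    using card_chains[OF assms, of "{}" "i * j"] by simp
  ultimately show ?thesis by (simp add: card_chains_descents[OF assms])
qed

text \<open>With \<open>R = (>)\<close> ties are listed from right to left, so strictness is forced
  at the ascents of \<open>inv \<sigma>\<close> instead of its descents. This flips the sign with
  which the inverse descent number enters, while every step of the grid chain becomes
  strict.\<close>

lemma Worpitzky_sets:
  assumes "n \<ge> 1"
  shows "(\<Sum>\<sigma> | \<sigma> permutes {1..n}. ((i + (n - 1 - descents n \<sigma>)) choose n) *
      ((j + descents n (inv \<sigma>)) choose n)) = (i * j) choose n"
proof -
  have "(\<Sum>\<sigma> | \<sigma> permutes {1..n}. card (chains n {m. \<sigma> (Suc m) < \<sigma> m} i) *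
      card (chains n {m. \<not> inv \<sigma> m > inv \<sigma> (Suc m)} j)) =
    card (chains n {m. \<not> m > Suc m} (i * j))"
    by (rule sum_card_chains_permutes) (auto simp: irreflp_def transp_def totalp_on_def)
  moreover have "card (chains n {m. \<not> inv \<sigma> m > inv \<sigma> (Suc m)} j) =
      ((j + descents n (inv \<sigma>)) choose n)" if "\<sigma> permutes {1..n}" for \<sigma>
  proof -
    have inj: "inj (inv \<sigma>)" using permutes_inj[OF permutes_inv[OF that]] .
    hence "inv \<sigma> m \<noteq> inv \<sigma> (Suc m)" for m by (metis injD n_not_Suc_n)
    hence "{m. \<not> inv \<sigma> m > inv \<sigma> (Suc m)} = {m. inv \<sigma> m < inv \<sigma> (Suc m)}"
      by (auto simp: not_less le_less)
    thus ?thesis using card_chains_ascents[OF assms inj] by simp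
  qed
  moreover have "card (chains n {m. \<not> m > Suc m} (i * j)) = (i * j) choose n"
  proof -
    have "chains n {m. \<not> m > Suc m} (i * j) = chains n {1..<n} (i * j)"
      by (rule chains_cong) auto
    thus ?thesis using card_chains[OF assms, of "{1..<n}" "i * j"] by simp
  qed
  ultimately show ?thesis by (simp add: card_chains_descents[OF assms])
qed

section \<open>Powers against binomial coefficients\<close>

text \<open>The right-hand side is the falling factorial N * (N - 1) * ... * (N - n + 1), whose
  smallest factor is at least \<open>K\<close>.\<close>

lemma power_le_fact_binomial:
  fixes K N n :: nat
  assumes "K + n \<le> N + 1"
  shows "K ^ n \<le> fact n * (N choose n)"
  using assms
proof (induction n)
  case (Suc n)
  have "K ^ Suc n \<le> (N - n) * (fact n * (N choose n))"
    using Suc by (auto intro!: mult_mono)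
  also have "\<dots> = fact n * ((N - n) * (N choose n))" by simp
  also have "(N - n) * (N choose n) = Suc n * (N choose Suc n)"
    using binomial_absorb_comp[of N n] Suc_times_binomial_add[of n "N - Suc n"]
      binomial_absorption[of n N] binomial_absorption[of n "N - 1"] Suc.prems
    by simp
  finally show ?case by (simp add: algebra_simps)
qed simp

text \<open>With \<open>m\<close> of order \<open>sqrt n\<close>, shifting \<open>i\<close> and \<open>j\<close> by \<open>m\<close> absorbs the difference
  between \<open>n!\<close> times the binomial coefficients and \<open>(i * j) ^ n\<close>, and decouples \<open>i\<close> from \<open>j\<close>.\<close>

lemma fact_binomial_le:
  assumes "n \<le> m * m"
  shows "fact n * ((i * j + (n - 1)) choose n) \<le> (i + m) ^ n * (j + m) ^ n"
proof -
  have "fact n * ((i * j + (n - 1)) choose n) \<le> (i * j + (n - 1)) ^ n"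
    using binomial_fact_pow[of "i * j + (n - 1)" n] by (simp add: mult.commute)
  also have "\<dots> \<le> ((i + m) * (j + m)) ^ n"
  proof (rule power_mono)
    have "i * j + (n - 1) \<le> i * j + m * m" using assms by simp
    also have "\<dots> \<le> (i + m) * (j + m)" by (simp add: algebra_simps)
    finally show "i * j + (n - 1) \<le> (i + m) * (j + m)" .
  qed simp
  finally show ?thesis by (simp add: power_mult_distrib)
qed

lemma fact_binomial_ge:
  assumes "n \<le> m * m" "n \<ge> 1"
  shows "(i - m) ^ n * (j - m) ^ n \<le> fact n * ((i * j) choose n)"
proof (cases "i > m \<and> j > m")
  case True
  have "(i - m) * (j - m) + m * m \<le> i * j"
  proof -
    obtain x y where "i = m + x" "j = m + y" using True less_imp_add_positive by blast
    thus ?thesis by (simp add: algebra_simps)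
  qed
  hence "(i - m) * (j - m) + n \<le> i * j + 1" using assms by linarith
  from power_le_fact_binomial[OF this] show ?thesis by (simp add: power_mult_distrib)
next
  case False
  \<comment> \<open>Truncated subtraction makes one base 0, and \<open>n \<ge> 1\<close> makes its
    power 0 as well.\<close>
  thus ?thesis using assms(2) by (auto simp: power_0_left)
qed

section \<open>The limit of the scaled cumulant generating functions\<close>

lemma negative_binomial_sums:
  fixes w :: real
  assumes "0 \<le> w" "w < 1"
  shows "(\<lambda>k. real ((n + k) choose n) * w ^ k) sums (1 / (1 - w) ^ Suc n)"
proof -
  have "(\<lambda>k. (- real (Suc n) gchoose k) * (- w) ^ k) sums (1 + (- w)) powr (- real (Suc n))"
    using assms by (intro gen_binomial_real) auto
  also have "(1 + (- w)) powr (- real (Suc n)) = 1 / (1 - w) ^ Suc n"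
    using assms by (simp add: powr_minus powr_realpow divide_inverse del: of_nat_Suc power_Suc)
  also have "(\<lambda>k. (- real (Suc n) gchoose k) * (- w) ^ k) = (\<lambda>k. real ((n + k) choose n) * w ^ k)"
  proof
    fix k
    have "(- real (Suc n) gchoose k) = (-1) ^ k * (real (n + k) gchoose k)"
      using gbinomial_minus[of "real (Suc n)" k] by (simp add: algebra_simps)
    also have "(real (n + k) gchoose k) = real ((n + k) choose k)"
      by (simp only: binomial_gbinomial)
    also have "(n + k) choose k = (n + k) choose n"
      using binomial_symmetric[of n "n + k"] by simp
    finally have "(- real (Suc n) gchoose k) * (- w) ^ k =
        real ((n + k) choose n) * ((-1) ^ k * (- w) ^ k)" by (simp only: mult_ac)
    also have "(-1) ^ k * (- w) ^ k = w ^ k" by (simp flip: power_mult_distrib)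
    finally show "(- real (Suc n) gchoose k) * (- w) ^ k = real ((n + k) choose n) * w ^ k" .
  qed
  finally show ?thesis .
qed

text \<open>The terms with \<open>i < n - e\<close> vanish, so this is Newton's series shifted by
  \<open>n - e\<close>. Later \<open>e\<close> is \<open>n - 1 - descents n \<sigma>\<close> or
  \<open>descents n (inv \<sigma>)\<close>, and the power of \<open>w\<close> then carries the
  descent number.\<close>

lemma binomial_shift_sums:
  fixes w :: real
  assumes "0 \<le> w" "w < 1" "e \<le> n"
  shows "(\<lambda>i. real ((i + e) choose n) * w ^ i) sums (w ^ (n - e) / (1 - w) ^ Suc n)"
proof -
  have "(\<lambda>k. w ^ (n - e) * (real ((n + k) choose n) * w ^ k)) sums
      (w ^ (n - e) * (1 / (1 - w) ^ Suc n))"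
    by (intro sums_mult negative_binomial_sums assms)
  also have "(\<lambda>k. w ^ (n - e) * (real ((n + k) choose n) * w ^ k)) =
      (\<lambda>k. real ((k + (n - e) + e) choose n) * w ^ (k + (n - e)))"
    using assms(3) by (simp add: fun_eq_iff add.commute mult_ac flip: power_add)
  finally show ?thesis
    using sums_zero_iff_shift[of "n - e" "\<lambda>i. real ((i + e) choose n) * w ^ i"]
    by (simp add: less_diff_conv)
qed

text \<open>The double series is summed one index at a time, first over \<open>j\<close> for fixed
  \<open>i\<close>, with a finite sum over \<open>S\<close> inside. Termwise comparison then works
  without any theory of double series.\<close>

lemma sum_sums_mult_le:
  fixes c d :: "'a \<Rightarrow> nat \<Rightarrow> real"
  assumes "\<And>x. x \<in> S \<Longrightarrow> c x sums C x" "\<And>x. x \<in> S \<Longrightarrow> d x sums D x"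
    and "p sums P" "q sums Q"
    and "\<And>i j. (\<Sum>x\<in>S. c x i * d x j) \<le> p i * q j"
  shows "(\<Sum>x\<in>S. C x * D x) \<le> P * Q"
proof (rule sums_le)
  show "(\<Sum>x\<in>S. c x i * D x) \<le> p i * Q" for i
    by (rule sums_le[where f = "\<lambda>j. \<Sum>x\<in>S. c x i * d x j" and g = "\<lambda>j. p i * q j"])
      (auto intro!: sums_sum sums_mult assms)
  show "(\<lambda>i. \<Sum>x\<in>S. c x i * D x) sums (\<Sum>x\<in>S. C x * D x)"
    by (intro sums_sum sums_mult2 assms)
  show "(\<lambda>i. p i * Q) sums (P * Q)" by (intro sums_mult2 assms)
qed

lemma sum_sums_mult_ge:
  fixes c d :: "'a \<Rightarrow> nat \<Rightarrow> real"
  assumes "\<And>x. x \<in> S \<Longrightarrow> c x sums C x" "\<And>x. x \<in> S \<Longrightarrow> d x sums D x"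
    and "p sums P" "q sums Q"
    and "\<And>i j. p i * q j \<le> (\<Sum>x\<in>S. c x i * d x j)"
  shows "P * Q \<le> (\<Sum>x\<in>S. C x * D x)"
proof (rule sums_le)
  show "p i * Q \<le> (\<Sum>x\<in>S. c x i * D x)" for i
    by (rule sums_le[where g = "\<lambda>j. \<Sum>x\<in>S. c x i * d x j" and f = "\<lambda>j. p i * q j"])
      (auto intro!: sums_sum sums_mult assms)
  show "(\<lambda>i. \<Sum>x\<in>S. c x i * D x) sums (\<Sum>x\<in>S. C x * D x)"
    by (intro sums_sum sums_mult2 assms)
  show "(\<lambda>i. p i * Q) sums (P * Q)" by (intro sums_mult2 assms)
qed

section \<open>Growth of the power-exponential series\<close>

text \<open>For \<open>n \<ge> 1\<close> and \<open>s > 0\<close> this is the polylogarithm of order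
  - n at exp (- s); it grows like n! / s ^ (n + 1).\<close>

definition pow_exp_sum :: "nat \<Rightarrow> real \<Rightarrow> real" where
  "pow_exp_sum n s = (\<Sum>i. real i ^ n * exp (- s) ^ i)"

lemma power_le_fact_exp:
  fixes x :: real
  assumes "x \<ge> 0"
  shows "x ^ n \<le> fact n * exp x"
proof -
  have s: "(\<lambda>k. x ^ k /\<^sub>R fact k) sums exp x" by (rule exp_converges)
  have "(\<Sum>k\<in>{n}. x ^ k /\<^sub>R fact k) \<le> (\<Sum>k. x ^ k /\<^sub>R fact k)"
    using assms sums_summable[OF s] by (intro sum_le_suminf) auto
  hence "x ^ n / fact n \<le> exp x" using sums_unique[OF s] by (simp add: divide_inverse mult.commute)
  thus ?thesis by (simp add: field_simps)
qed

text \<open>Keeping one term of the exponential series bounds (\<theta> i) ^ n by n! exp (\<theta>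
  i). What remains is a geometric series, convergent for \<open>\<theta> < s\<close>; letting
  \<open>\<theta>\<close> approach \<open>s\<close> gives the sharp rate.\<close>

lemma pow_exp_term_le:
  fixes \<theta> s :: real
  assumes "0 < \<theta>"
  shows "real i ^ n * exp (- s) ^ i \<le> (fact n / \<theta> ^ n) * exp (\<theta> - s) ^ i"
proof -
  have "(\<theta> * real i) ^ n \<le> fact n * exp (\<theta> * real i)"
    using assms by (intro power_le_fact_exp) auto
  hence "real i ^ n \<le> fact n / \<theta> ^ n * exp \<theta> ^ i"
    using assms by (simp add: power_mult_distrib field_simps flip: exp_of_nat_mult)
  hence "real i ^ n * exp (- s) ^ i \<le> fact n / \<theta> ^ n * exp \<theta> ^ i * exp (- s) ^ i"
    by (intro mult_right_mono) auto
  also have "\<dots> = (fact n / \<theta> ^ n) * exp (\<theta> - s) ^ i"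
    by (simp add: exp_diff exp_minus power_divide divide_inverse power_inverse power_mult_distrib)
  finally show ?thesis .
qed

lemma pow_exp_summable:
  assumes "s > 0"
  shows "summable (\<lambda>i. real i ^ n * exp (- s) ^ i)"
proof (rule summable_comparison_test')
  show "summable (\<lambda>i. (fact n / (s / 2) ^ n) * exp (s / 2 - s) ^ i)"
    using assms by (intro summable_mult summable_geometric) auto
  show "norm (real i ^ n * exp (- s) ^ i) \<le> (fact n / (s / 2) ^ n) * exp (s / 2 - s) ^ i" for i
    using pow_exp_term_le[of "s / 2" i n s] assms by simp
qed

lemma pow_exp_sums: "s > 0 \<Longrightarrow> (\<lambda>i. real i ^ n * exp (- s) ^ i) sums pow_exp_sum n s"
  unfolding pow_exp_sum_def by (intro summable_sums pow_exp_summable)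

lemma pow_exp_sum_le:
  assumes "0 < \<theta>" "\<theta> < s"
  shows "pow_exp_sum n s \<le> (fact n / \<theta> ^ n) * (1 / (1 - exp (\<theta> - s)))"
  using assms by (intro sums_le[OF pow_exp_term_le pow_exp_sums sums_mult[OF geometric_sums]]) auto

text \<open>Half of Stirling's formula with a linear loss, n! \<le> e n (n / e) ^ n. The induction
  step rests on e n ^ (n + 1) \<le> (n + 1) ^ (n + 1), that is, on ln u \<le> u - 1 at u = n / (n +
  1).\<close>

lemma fact_le_power_exp:
  assumes "n \<ge> 1"
  shows "fact n * exp (real n) \<le> exp 1 * real n ^ Suc n"
  using assms
proof (induction n rule: dec_induct)
  case (step n)
  have n: "real n > 0" using step by simp
  have "exp 1 * real n ^ Suc n \<le> real (Suc n) ^ Suc n"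
  proof -
    have "ln (real n / real (Suc n)) \<le> real n / real (Suc n) - 1"
      using n by (intro ln_le_minus_one) auto
    hence "real (Suc n) * ln (real n / real (Suc n)) \<le> real (Suc n) * (real n / real (Suc n) - 1)"
      by (intro mult_left_mono) auto
    also have "\<dots> = -1" by (simp add: field_simps)
    finally have "1 + real (Suc n) * ln (real n) \<le> real (Suc n) * ln (real (Suc n))"
      using n by (simp add: ln_div algebra_simps)
    hence "exp (1 + real (Suc n) * ln (real n)) \<le> exp (real (Suc n) * ln (real (Suc n)))" by simp
    thus ?thesis using n by (simp add: exp_add exp_of_nat_mult del: of_nat_Suc power_Suc)
  qed
  hence "real (Suc n) * exp 1 * (exp 1 * real n ^ Suc n) \<le> real (Suc n) * exp 1 * real (Suc n) ^ Suc n"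
    by (intro mult_left_mono) auto
  moreover have "real (Suc n) * exp 1 * (fact n * exp (real n)) \<le> real (Suc n) * exp 1 * (exp 1 * real n ^ Suc n)"
    using step by (intro mult_left_mono) auto
  ultimately show ?case by (simp add: exp_add algebra_simps)
qed simp

lemma pow_exp_sum_ge:
  assumes "s > 0" "n \<ge> 1"
  shows "fact n * exp (- s - 1) / (real n * s ^ n) \<le> pow_exp_sum n s"
proof -
  \<comment> \<open>The map x -> x ^ n exp (- s x) peaks at x = n / s, and this single term already
    has the right exponential size. Rounding up costs at most the factor exp (- s).\<close>
  define i where "i = nat \<lceil>real n / s\<rceil>"
  have i: "real n / s \<le> real i" "real i \<le> real n / s + 1"
    using assms by (auto simp: i_def)
  have "s * real i \<le> real n + s" using i(2) assms by (simp add: field_simps)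
  hence "exp (- real n - s) \<le> exp (- s) ^ i"
    by (simp flip: exp_of_nat_mult) (simp add: mult.commute)
  moreover have "(real n / s) ^ n \<le> real i ^ n" using i assms by (intro power_mono) auto
  ultimately have "(real n / s) ^ n * exp (- real n - s) \<le> real i ^ n * exp (- s) ^ i"
    by (intro mult_mono) auto
  also have "\<dots> = (\<Sum>k\<in>{i}. real k ^ n * exp (- s) ^ k)" by simp
  also have "\<dots> \<le> pow_exp_sum n s"
    unfolding pow_exp_sum_def using pow_exp_summable[OF assms(1)]
    by (intro sum_le_suminf) auto
  finally have *: "(real n / s) ^ n * exp (- real n - s) \<le> pow_exp_sum n s" .
  have "fact n * exp (- s - 1) / (real n * s ^ n) = 
      fact n * exp (real n) * (exp (- s - 1 - real n) / (real n * s ^ n))"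
    by (simp add: exp_diff exp_minus exp_add field_simps)
  also have "\<dots> \<le> exp 1 * real n ^ Suc n * (exp (- s - 1 - real n) / (real n * s ^ n))"
    using fact_le_power_exp[OF assms(2)] assms by (intro mult_right_mono) auto
  also have "\<dots> = (real n / s) ^ n * exp (- real n - s)"
    using assms by (simp add: exp_diff exp_minus exp_add field_simps)
  finally show ?thesis using * by linarith
qed

lemma pow_exp_sum_pos:
  assumes "s > 0" "n \<ge> 1"
  shows "pow_exp_sum n s > 0"
proof -
  have "0 < fact n * exp (- s - 1) / (real n * s ^ n)" using assms by simp
  thus ?thesis using pow_exp_sum_ge[OF assms] by linarith
qed

lemma pow_exp_sum_lim:
  assumes s: "s > 0"
  shows "(\<lambda>n. ln (pow_exp_sum n s / fact n) / real n) \<longlonglongrightarrow> - ln s"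
proof (rule order_tendstoI)
  fix a assume a: "a < - ln s"
  have "(\<lambda>n. (- s - 1 - ln (real n)) / real n - ln s) \<longlonglongrightarrow> - ln s" by real_asymp
  from order_tendstoD(1)[OF this a]
  have "\<forall>\<^sub>F n in sequentially. a < (- s - 1 - ln (real n)) / real n - ln s" .
  with eventually_ge_at_top[of 1]
  show "\<forall>\<^sub>F n in sequentially. a < ln (pow_exp_sum n s / fact n) / real n"
  proof eventually_elim
    case (elim n)
    have n: "real n > 0" using elim by simp
    have "exp (- s - 1) / (real n * s ^ n) \<le> pow_exp_sum n s / fact n"
      using pow_exp_sum_ge[OF s elim(1)] by (simp add: field_simps)
    moreover have "0 < exp (- s - 1) / (real n * s ^ n)" using n s by simp
    ultimately have "ln (exp (- s - 1) / (real n * s ^ n)) \<le> ln (pow_exp_sum n s / fact n)"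
      by (rule ln_mono)
    also have "ln (exp (- s - 1) / (real n * s ^ n)) = - s - 1 - ln (real n) - real n * ln s"
      using n s by (simp add: ln_div ln_mult ln_realpow)
    finally have "(- s - 1 - ln (real n) - real n * ln s) / real n \<le> ln (pow_exp_sum n s / fact n) / real n"
      using n by (intro divide_right_mono) auto
    thus ?case using elim n by (simp add: diff_divide_distrib)
  qed
next
  fix a assume a: "- ln s < a"
  have "exp (- a) < s" using a s by (metis exp_less_mono exp_ln minus_less_iff)
  \<comment> \<open>The first inequality makes the rate \<open>- ln \<theta>\<close> smaller than
    \<open>a\<close>, the second keeps the geometric series convergent; its constant
    \<open>1 / K\<close> vanishes in the limit.\<close>
  then obtain \<theta> where \<theta>: "exp (- a) < \<theta>" "\<theta> < s" using dense by blast
  have \<theta>0: "\<theta> > 0" using \<theta>(1) exp_gt_zero[of "- a"] by linarith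
  have "- ln \<theta> < a" using \<theta>(1) \<theta>0 by (metis exp_gt_zero ln_exp ln_less_cancel_iff minus_less_iff)
  define K where "K = 1 - exp (\<theta> - s)"
  have K: "K > 0" using \<theta> by (simp add: K_def)
  have "(\<lambda>n. - ln \<theta> - ln K / real n) \<longlonglongrightarrow> - ln \<theta>" by real_asymp
  from order_tendstoD(2)[OF this \<open>- ln \<theta> < a\<close>] eventually_ge_at_top[of 1]
  show "\<forall>\<^sub>F n in sequentially. ln (pow_exp_sum n s / fact n) / real n < a"
  proof eventually_elim
    case (elim n)
    have n: "real n > 0" using elim by simp
    have "pow_exp_sum n s / fact n \<le> 1 / (\<theta> ^ n * K)"
      using pow_exp_sum_le[OF \<theta>0 \<theta>(2), of n] K \<theta>0
      unfolding K_def[symmetric] by (simp add: field_simps)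
    hence "ln (pow_exp_sum n s / fact n) \<le> ln (1 / (\<theta> ^ n * K))"
      using pow_exp_sum_pos[OF s elim(2)] by (intro ln_mono) auto
    also have "\<dots> = - real n * ln \<theta> - ln K"
      using \<theta>0 K by (simp add: ln_div ln_mult ln_realpow)
    finally have "ln (pow_exp_sum n s / fact n) / real n \<le> (- real n * ln \<theta> - ln K) / real n"
      using n by (intro divide_right_mono) auto
    thus ?case using elim n by (simp add: diff_divide_distrib)
  qed
qed

lemma pow_exp_shift_sums_le:
  assumes s: "s > 0"
  obtains P where "(\<lambda>i. real (i + m) ^ n * exp (- s) ^ i) sums P"
    "P \<le> exp (s * real m) * pow_exp_sum n s"
proof -
  let ?f = "\<lambda>i. real i ^ n * exp (- s) ^ i"
  have e: "exp (s * real m) * exp (- s) ^ (i + m) = exp (- s) ^ i" for i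
    by (simp flip: exp_of_nat_mult exp_add) (simp add: algebra_simps)
  have "summable (\<lambda>i. ?f (i + m))"
    using pow_exp_summable[OF s] by (rule summable_ignore_initial_segment)
  moreover have "(\<Sum>i. ?f (i + m)) \<le> (\<Sum>i. ?f i)"
    using suminf_split_initial_segment[OF pow_exp_summable[OF s, of n], of m]
    by (simp add: sum_nonneg)
  ultimately have sums: "(\<lambda>i. exp (s * real m) * ?f (i + m)) sums (exp (s * real m) * (\<Sum>i. ?f (i + m)))"
    and le: "exp (s * real m) * (\<Sum>i. ?f (i + m)) \<le> exp (s * real m) * pow_exp_sum n s"
    by (auto intro: sums_mult summable_sums simp: pow_exp_sum_def)
  have eq: "(\<lambda>i. exp (s * real m) * ?f (i + m)) = (\<lambda>i. real (i + m) ^ n * exp (- s) ^ i)"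
    using e by (simp add: fun_eq_iff mult.left_commute)
  show ?thesis by (rule that[OF sums[unfolded eq] le])
qed

text \<open>An equality, because truncated subtraction together with \<open>n \<ge> 1\<close> kills
  the first \<open>m\<close> terms. Shifting the index the other way drops terms and gives only an
  upper bound.\<close>

lemma pow_exp_shift_sums_eq:
  assumes s: "s > 0" and n: "n \<ge> 1"
  shows "(\<lambda>i. real (i - m) ^ n * exp (- s) ^ i) sums (exp (- s * real m) * pow_exp_sum n s)"
proof -
  have "(\<lambda>i. exp (- s * real m) * (real i ^ n * exp (- s) ^ i)) sums (exp (- s * real m) * pow_exp_sum n s)"
    by (intro sums_mult pow_exp_sums s)
  also have "(\<lambda>i. exp (- s * real m) * (real i ^ n * exp (- s) ^ i)) =
      (\<lambda>i. real (i + m - m) ^ n * exp (- s) ^ (i + m))"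
    by (auto simp: fun_eq_iff power_add mult_ac simp flip: exp_of_nat_mult)
  finally show ?thesis
    using n sums_zero_iff_shift[of m "\<lambda>i. real (i - m) ^ n * exp (- s) ^ i"]
    by (simp add: power_0_left)
qed

text \<open>The generating function argument, stated once for both Worpitzky identities. The bounds
  \<open>le\<close> and \<open>ge\<close> factor in \<open>i\<close> and \<open>j\<close> at the
  price of shifts by \<open>m\<close>, and a shift multiplies the series by at most exp (s m) or
  exactly exp (- s m). Taking \<open>m\<close> as the ceiling of sqrt n makes these factors
  subexponential.\<close>

lemma sum_sums_lim:
  fixes c d :: "nat \<Rightarrow> 'a \<Rightarrow> nat \<Rightarrow> nat" and s t :: real
  assumes s: "s > 0" and t: "t > 0"
    and C: "\<And>n x. n \<ge> 1 \<Longrightarrow> x \<in> S n \<Longrightarrow> (\<lambda>i. real (c n x i) * exp (- s) ^ i) sums C n x"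
    and D: "\<And>n x. n \<ge> 1 \<Longrightarrow> x \<in> S n \<Longrightarrow> (\<lambda>i. real (d n x i) * exp (- t) ^ i) sums D n x"
    and le: "\<And>n m i j. n \<ge> 1 \<Longrightarrow> n \<le> m * m \<Longrightarrow>
      fact n * (\<Sum>x\<in>S n. c n x i * d n x j) \<le> (i + m) ^ n * (j + m) ^ n"
    and ge: "\<And>n m i j. n \<ge> 1 \<Longrightarrow> n \<le> m * m \<Longrightarrow>
      (i - m) ^ n * (j - m) ^ n \<le> fact n * (\<Sum>x\<in>S n. c n x i * d n x j)"
  shows "(\<lambda>n. ln ((\<Sum>x\<in>S n. C n x * D n x) / fact n) / real n) \<longlonglongrightarrow> - ln s - ln t"
proof -
  define m where "m = (\<lambda>n. nat \<lceil>sqrt (real n)\<rceil>)"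
  define X where "X = (\<lambda>n. \<Sum>x\<in>S n. C n x * D n x)"
  define b where "b = (\<lambda>n. pow_exp_sum n s / fact n * (pow_exp_sum n t / fact n))"
  have mle: "real (m n) \<le> sqrt (real n) + 1" for n
    unfolding m_def by (simp add: of_nat_nat of_int_ceiling_le_add_one)
  have m: "n \<le> m n * m n" for n
  proof -
    have "sqrt (real n) \<le> real (m n)" unfolding m_def by (simp add: real_nat_ceiling_ge)
    hence "sqrt (real n) * sqrt (real n) \<le> real (m n) * real (m n)" by (intro mult_mono) auto
    thus ?thesis by (simp flip: of_nat_mult)
  qed
  have bpos: "b n > 0" if "n \<ge> 1" for n
    using pow_exp_sum_pos[OF s that] pow_exp_sum_pos[OF t that] by (simp add: b_def)
  \<comment> \<open>Attaching \<open>fact n\<close> to the second family brings the sum into the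
    form bounded by \<open>le\<close> and \<open>ge\<close> over the natural numbers.\<close>
  have distr: "(\<Sum>x\<in>S n. real (c n x i) * exp (- s) ^ i * (fact n * (real (d n x j) * exp (- t) ^ j))) =
      real (fact n * (\<Sum>x\<in>S n. c n x i * d n x j)) * (exp (- s) ^ i * exp (- t) ^ j)" for n i j
    by (simp add: sum_distrib_left sum_distrib_right mult_ac)
  have sumD: "(\<lambda>i. fact n * (real (d n x i) * exp (- t) ^ i)) sums (fact n * D n x)"
    if "n \<ge> 1" "x \<in> S n" for n x
    by (intro sums_mult D that)
  have sumX: "(\<Sum>x\<in>S n. C n x * (fact n * D n x)) = fact n * X n" for n
    by (simp add: X_def sum_distrib_left mult.left_commute)
  have upper: "X n / fact n \<le> exp ((s + t) * real (m n)) * b n" if n: "n \<ge> 1" for n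
  proof -
    obtain P where P: "(\<lambda>i. real (i + m n) ^ n * exp (- s) ^ i) sums P"
      "P \<le> exp (s * real (m n)) * pow_exp_sum n s" using pow_exp_shift_sums_le[OF s] .
    obtain Q where Q: "(\<lambda>i. real (i + m n) ^ n * exp (- t) ^ i) sums Q"
      "Q \<le> exp (t * real (m n)) * pow_exp_sum n t" using pow_exp_shift_sums_le[OF t] .
    have "(\<Sum>x\<in>S n. C n x * (fact n * D n x)) \<le> P * Q"
    proof (rule sum_sums_mult_le[OF C[OF n] sumD[OF n] P(1) Q(1)])
      fix i j
      have "real (fact n * (\<Sum>x\<in>S n. c n x i * d n x j)) \<le> real ((i + m n) ^ n * (j + m n) ^ n)"
        using le[OF n m] by (simp only: of_nat_le_iff)
      hence "real (fact n * (\<Sum>x\<in>S n. c n x i * d n x j)) * (exp (- s) ^ i * exp (- t) ^ j) \<le>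
          real ((i + m n) ^ n * (j + m n) ^ n) * (exp (- s) ^ i * exp (- t) ^ j)"
        by (intro mult_right_mono) auto
      thus "(\<Sum>x\<in>S n. real (c n x i) * exp (- s) ^ i * (fact n * (real (d n x j) * exp (- t) ^ j))) \<le>
          real (i + m n) ^ n * exp (- s) ^ i * (real (j + m n) ^ n * exp (- t) ^ j)"
        unfolding distr by (simp add: mult_ac)
    qed
    also have "P * Q \<le> (exp (s * real (m n)) * pow_exp_sum n s) * (exp (t * real (m n)) * pow_exp_sum n t)"
    proof (intro mult_mono P Q)
      show "0 \<le> Q" by (rule sums_le[OF _ sums_zero Q(1)]) auto
      show "0 \<le> exp (s * real (m n)) * pow_exp_sum n s" using pow_exp_sum_pos[OF s n] by simp
    qed
    finally have "fact n * X n \<le> (fact n * fact n) * (exp ((s + t) * real (m n)) * b n)"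
      unfolding sumX b_def distrib_right exp_add by (simp add: mult_ac)
    thus ?thesis by (simp add: field_simps)
  qed
  have lower: "exp (- (s + t) * real (m n)) * b n \<le> X n / fact n" if n: "n \<ge> 1" for n
  proof -
    have "(exp (- s * real (m n)) * pow_exp_sum n s) * (exp (- t * real (m n)) * pow_exp_sum n t) \<le>
        (\<Sum>x\<in>S n. C n x * (fact n * D n x))"
    proof (rule sum_sums_mult_ge[OF C[OF n] sumD[OF n]
          pow_exp_shift_sums_eq[OF s n] pow_exp_shift_sums_eq[OF t n]])
      fix i j
      have "real ((i - m n) ^ n * (j - m n) ^ n) \<le> real (fact n * (\<Sum>x\<in>S n. c n x i * d n x j))"
        using ge[OF n m] by (simp only: of_nat_le_iff)
      hence "real ((i - m n) ^ n * (j - m n) ^ n) * (exp (- s) ^ i * exp (- t) ^ j) \<le>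
          real (fact n * (\<Sum>x\<in>S n. c n x i * d n x j)) * (exp (- s) ^ i * exp (- t) ^ j)"
        by (intro mult_right_mono) auto
      thus "real (i - m n) ^ n * exp (- s) ^ i * (real (j - m n) ^ n * exp (- t) ^ j) \<le>
          (\<Sum>x\<in>S n. real (c n x i) * exp (- s) ^ i * (fact n * (real (d n x j) * exp (- t) ^ j)))"
        unfolding distr by (simp add: mult_ac)
    qed
    hence "(fact n * fact n) * (exp (- (s + t) * real (m n)) * b n) \<le> fact n * X n"
      unfolding sumX b_def minus_add_distrib distrib_right exp_add by (simp add: mult_ac)
    thus ?thesis by (simp add: field_simps)
  qed
  have Xpos: "X n / fact n > 0" if "n \<ge> 1" for n
  proof -
    have "0 < exp (- (s + t) * real (m n)) * b n" using bpos[OF that] by simp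
    thus ?thesis using lower[OF that] by linarith
  qed
  have m0: "(\<lambda>n. real (m n) / real n) \<longlonglongrightarrow> 0"
  proof (rule tendsto_sandwich[where f = "\<lambda>_. 0"])
    show "(\<lambda>n. (sqrt (real n) + 1) / real n) \<longlonglongrightarrow> 0" by real_asymp
    show "\<forall>\<^sub>F n in sequentially. real (m n) / real n \<le> (sqrt (real n) + 1) / real n"
      using mle by (intro always_eventually allI divide_right_mono) auto
  qed auto
  have lnb: "(\<lambda>n. ln (pow_exp_sum n s / fact n) / real n + ln (pow_exp_sum n t / fact n) / real n)
      \<longlonglongrightarrow> - ln s - ln t"
    using tendsto_add[OF pow_exp_sum_lim[OF s] pow_exp_sum_lim[OF t]] by simp
  have lnb_eq: "ln (b n) / real n =
      ln (pow_exp_sum n s / fact n) / real n + ln (pow_exp_sum n t / fact n) / real n" if "n \<ge> 1" for n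
    using pow_exp_sum_pos[OF s that] pow_exp_sum_pos[OF t that]
    unfolding b_def by (subst ln_mult) (auto simp: add_divide_distrib)
  have lnb': "(\<lambda>n. ln (b n) / real n) \<longlonglongrightarrow> - ln s - ln t"
    by (rule Lim_transform_eventually[OF lnb])
      (use lnb_eq in \<open>auto intro: eventually_mono[OF eventually_ge_at_top[of 1]]\<close>)
  have "(\<lambda>n. ln (X n / fact n) / real n) \<longlonglongrightarrow> - ln s - ln t"
  proof (rule tendsto_sandwich)
    show "(\<lambda>n. ln (b n) / real n - (s + t) * (real (m n) / real n)) \<longlonglongrightarrow> - ln s - ln t"
      using tendsto_diff[OF lnb' tendsto_mult[OF tendsto_const m0, of "s + t"]] by simp
    show "(\<lambda>n. ln (b n) / real n + (s + t) * (real (m n) / real n)) \<longlonglongrightarrow> - ln s - ln t"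
      using tendsto_add[OF lnb' tendsto_mult[OF tendsto_const m0, of "s + t"]] by simp
    show "\<forall>\<^sub>F n in sequentially. ln (b n) / real n - (s + t) * (real (m n) / real n) \<le> ln (X n / fact n) / real n"
      using eventually_ge_at_top[of 1]
    proof eventually_elim
      case (elim n)
      have "ln (exp (- (s + t) * real (m n)) * b n) \<le> ln (X n / fact n)"
        using lower[OF elim] bpos[OF elim] by (intro ln_mono) auto
      hence "(- (s + t) * real (m n) + ln (b n)) / real n \<le> ln (X n / fact n) / real n"
        using bpos[OF elim] by (intro divide_right_mono) (auto simp: ln_mult)
      thus ?case by (simp add: add_divide_distrib diff_divide_distrib algebra_simps)
    qed
    show "\<forall>\<^sub>F n in sequentially. ln (X n / fact n) / real n \<le> ln (b n) / real n + (s + t) * (real (m n) / real n)"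
      using eventually_ge_at_top[of 1]
    proof eventually_elim
      case (elim n)
      have "ln (X n / fact n) \<le> ln (exp ((s + t) * real (m n)) * b n)"
        using upper[OF elim] Xpos[OF elim] by (intro ln_mono) auto
      hence "ln (X n / fact n) / real n \<le> ((s + t) * real (m n) + ln (b n)) / real n"
        using bpos[OF elim] by (intro divide_right_mono) (auto simp: ln_mult)
      thus ?case by (simp add: add_divide_distrib algebra_simps)
    qed
  qed
  thus "(\<lambda>n. ln ((\<Sum>x\<in>S n. C n x * D n x) / fact n) / real n) \<longlonglongrightarrow> - ln s - ln t"
    by (simp add: X_def)
qed

section \<open>The joint moment generating function\<close>

definition desc_mgf :: "nat \<Rightarrow> real \<Rightarrow> real \<Rightarrow> real" where
  "desc_mgf n s t = (\<Sum>\<sigma> | \<sigma> permutes {1..n}.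
     exp (s * real (descents n \<sigma>) + t * real (descents n (inv \<sigma>)))) / fact n"

lemma desc_mgf_pos: "desc_mgf n s t > 0"
  unfolding desc_mgf_def
  by (intro divide_pos_pos sum_pos) (auto simp: finite_permutations intro: permutes_id)

lemma desc_mgf_mono:
  assumes "s \<le> s'" "t \<le> t'"
  shows "desc_mgf n s t \<le> desc_mgf n s' t'"
  unfolding desc_mgf_def using assms
  by (intro divide_right_mono sum_mono) (auto intro!: add_mono mult_right_mono)

lemma L_neg: "s > 0 \<Longrightarrow> L (- s) = ln (1 - exp (- s)) - ln s"
proof -
  assume s: "s > 0"
  have "(exp (- s) - 1) / (- s) = (1 - exp (- s)) / s"
    by (metis minus_diff_eq minus_divide_divide)
  thus ?thesis using s by (simp add: L_def ln_div)
qed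

lemma L_pos: "s > 0 \<Longrightarrow> L s = s + L (- s)"
proof -
  assume s: "s > 0"
  have "(exp s - 1) / s = exp s * ((1 - exp (- s)) / s)"
    by (simp add: right_diff_distrib flip: exp_add)
  hence "L s = ln (exp s * ((1 - exp (- s)) / s))" using s by (simp add: L_def)
  also have "\<dots> = s + ln ((1 - exp (- s)) / s)"
    using s by (subst ln_mult) auto
  finally show ?thesis using L_neg[OF s] s by (simp add: ln_div)
qed

lemma desc_mgf_lim_neg_neg:
  assumes s: "s > 0" and t: "t > 0"
  shows "(\<lambda>n. ln (desc_mgf n (- s) (- t)) / real n) \<longlonglongrightarrow> L (- s) + L (- t)"
proof -
  let ?S = "\<lambda>n::nat. {\<sigma>. \<sigma> permutes {1..n}}"
  define w z where "w = exp (- s)" and "z = exp (- t)"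
  have w: "0 < w" "w < 1" and z: "0 < z" "z < 1" using s t by (auto simp: w_def z_def)
  define C where "C = (\<lambda>n \<sigma>. w ^ (n - (n - 1 - descents n \<sigma>)) / (1 - w) ^ Suc n)"
  define D where "D = (\<lambda>n \<sigma>. z ^ (n - (n - 1 - descents n (inv \<sigma>))) / (1 - z) ^ Suc n)"
  have lim: "(\<lambda>n. ln ((\<Sum>\<sigma>\<in>?S n. C n \<sigma> * D n \<sigma>) / fact n) / real n) \<longlonglongrightarrow> - ln s - ln t"
  proof (rule sum_sums_lim[OF s t, where c = "\<lambda>n \<sigma> i. (i + (n - 1 - descents n \<sigma>)) choose n"
          and d = "\<lambda>n \<sigma> j. (j + (n - 1 - descents n (inv \<sigma>))) choose n"])
    show "fact n * (\<Sum>\<sigma>\<in>?S n. ((i + (n - 1 - descents n \<sigma>)) choose n) *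
        ((j + (n - 1 - descents n (inv \<sigma>))) choose n)) \<le> (i + m) ^ n * (j + m) ^ n"
      if "n \<ge> 1" "n \<le> m * m" for n m i j
      unfolding Worpitzky_multisets[OF that(1)] by (rule fact_binomial_le[OF that(2)])
    show "(i - m) ^ n * (j - m) ^ n \<le> fact n * (\<Sum>\<sigma>\<in>?S n. ((i + (n - 1 - descents n \<sigma>)) choose n) *
        ((j + (n - 1 - descents n (inv \<sigma>))) choose n))"
      if "n \<ge> 1" "n \<le> m * m" for n m i j
    proof -
      have "(i - m) ^ n * (j - m) ^ n \<le> fact n * ((i * j) choose n)"
        by (rule fact_binomial_ge[OF that(2,1)])
      also have "\<dots> \<le> fact n * ((i * j + (n - 1)) choose n)"
        by (intro mult_left_mono binomial_right_mono) auto
      finally show ?thesis unfolding Worpitzky_multisets[OF that(1)] .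
    qed
  qed (use w z in \<open>auto simp: C_def D_def w_def[symmetric] z_def[symmetric]
        simp del: power_Suc intro!: binomial_shift_sums\<close>)
  have eq: "(\<Sum>\<sigma>\<in>?S n. C n \<sigma> * D n \<sigma>) / fact n =
      desc_mgf n (- s) (- t) * (w * z / ((1 - w) ^ Suc n * (1 - z) ^ Suc n))" if "n \<ge> 1" for n
  proof -
    have "C n \<sigma> * D n \<sigma> = exp (- s * real (descents n \<sigma>) + - t * real (descents n (inv \<sigma>))) *
        (w * z / ((1 - w) ^ Suc n * (1 - z) ^ Suc n))" for \<sigma>
    proof -
      \<comment> \<open>Subtraction is truncated, so this uses that there are at most
        \<open>n - 1\<close> descents. The extra 1 yields the factor \<open>w * z\<close>, which
        does not affect the rate.\<close>
      have e: "n - (n - 1 - descents n \<sigma>) = Suc (descents n \<sigma>)" for \<sigma>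
        using descents_le[of n \<sigma>] that by simp
      have p: "w ^ k = exp (- s * real k)" "z ^ k = exp (- t * real k)" for k
        by (simp_all add: w_def z_def mult.commute flip: exp_of_nat_mult)
      show ?thesis unfolding C_def D_def e power_Suc[of w "descents n \<sigma>"]
          power_Suc[of z "descents n (inv \<sigma>)"] p[of "descents n _"] exp_add by simp
    qed
    thus ?thesis by (simp only: desc_mgf_def times_divide_eq_left flip: sum_distrib_right)
  qed
  have ln_eq: "ln ((\<Sum>\<sigma>\<in>?S n. C n \<sigma> * D n \<sigma>) / fact n) / real n + (s + t) / real n +
      (1 + 1 / real n) * (ln (1 - w) + ln (1 - z)) = ln (desc_mgf n (- s) (- t)) / real n" if "n \<ge> 1" for n
  proof -
    have "ln ((\<Sum>\<sigma>\<in>?S n. C n \<sigma> * D n \<sigma>) / fact n) = ln (desc_mgf n (- s) (- t)) +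
       (ln w + ln z - (real (Suc n) * ln (1 - w) + real (Suc n) * ln (1 - z)))"
      unfolding eq[OF that] using w z desc_mgf_pos[of n "- s" "- t"]
      by (simp add: ln_mult ln_div ln_realpow del: power_Suc of_nat_Suc)
    moreover have "ln w = - s" "ln z = - t" by (simp_all add: w_def z_def)
    ultimately have "ln (desc_mgf n (- s) (- t)) = ln ((\<Sum>\<sigma>\<in>?S n. C n \<sigma> * D n \<sigma>) / fact n) +
        (s + t) + (real n + 1) * (ln (1 - w) + ln (1 - z))"
      by (simp add: algebra_simps)
    moreover have "(1 + 1 / real n) * K = (real n + 1) * K / real n" for K
      using that by (simp add: field_simps)
    ultimately show ?thesis using that by (simp only: add_divide_distrib)
  qed
  have "(\<lambda>n. ln ((\<Sum>\<sigma>\<in>?S n. C n \<sigma> * D n \<sigma>) / fact n) / real n + (s + t) / real n +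
      (1 + 1 / real n) * (ln (1 - w) + ln (1 - z)))
      \<longlonglongrightarrow> (- ln s - ln t) + 0 + (1 + 0) * (ln (1 - w) + ln (1 - z))"
    by (intro tendsto_add lim tendsto_mult tendsto_const lim_const_over_n lim_1_over_n)
  moreover have "(- ln s - ln t) + 0 + (1 + 0) * (ln (1 - w) + ln (1 - z)) = L (- s) + L (- t)"
    by (simp add: L_neg[OF s] L_neg[OF t] w_def z_def)
  ultimately show ?thesis
    using ln_eq by (auto elim!: Lim_transform_eventually
        intro: eventually_mono[OF eventually_ge_at_top[of 1]])
qed

text \<open>Here the second series gives z ^ (n - D') = exp (t D') z ^ n, a tilt of positive sign.
  The factor z ^ n adds \<open>t\<close> to the limit, which is the difference between
  \<open>L t\<close> and \<open>L (- t)\<close>.\<close>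

lemma desc_mgf_lim_neg_pos:
  assumes s: "s > 0" and t: "t > 0"
  shows "(\<lambda>n. ln (desc_mgf n (- s) t) / real n) \<longlonglongrightarrow> L (- s) + L t"
proof -
  let ?S = "\<lambda>n::nat. {\<sigma>. \<sigma> permutes {1..n}}"
  define w z where "w = exp (- s)" and "z = exp (- t)"
  have w: "0 < w" "w < 1" and z: "0 < z" "z < 1" using s t by (auto simp: w_def z_def)
  define C where "C = (\<lambda>n \<sigma>. w ^ (n - (n - 1 - descents n \<sigma>)) / (1 - w) ^ Suc n)"
  define D where "D = (\<lambda>n \<sigma>. z ^ (n - descents n (inv \<sigma>)) / (1 - z) ^ Suc n)"
  have desc_le_n: "descents n \<sigma> \<le> n" for n \<sigma> using descents_le[of n \<sigma>] by simp
  have lim: "(\<lambda>n. ln ((\<Sum>\<sigma>\<in>?S n. C n \<sigma> * D n \<sigma>) / fact n) / real n) \<longlonglongrightarrow> - ln s - ln t"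
  proof (rule sum_sums_lim[OF s t, where c = "\<lambda>n \<sigma> i. (i + (n - 1 - descents n \<sigma>)) choose n"
          and d = "\<lambda>n \<sigma> j. (j + descents n (inv \<sigma>)) choose n"])
    show "fact n * (\<Sum>\<sigma>\<in>?S n. ((i + (n - 1 - descents n \<sigma>)) choose n) *
        ((j + descents n (inv \<sigma>)) choose n)) \<le> (i + m) ^ n * (j + m) ^ n"
      if "n \<ge> 1" "n \<le> m * m" for n m i j
    proof -
      have "fact n * ((i * j) choose n) \<le> fact n * ((i * j + (n - 1)) choose n)"
        by (intro mult_left_mono binomial_right_mono) auto
      also have "\<dots> \<le> (i + m) ^ n * (j + m) ^ n" by (rule fact_binomial_le[OF that(2)])
      finally show ?thesis unfolding Worpitzky_sets[OF that(1)] .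
    qed
    show "(i - m) ^ n * (j - m) ^ n \<le> fact n * (\<Sum>\<sigma>\<in>?S n. ((i + (n - 1 - descents n \<sigma>)) choose n) *
        ((j + descents n (inv \<sigma>)) choose n))"
      if "n \<ge> 1" "n \<le> m * m" for n m i j
      unfolding Worpitzky_sets[OF that(1)] by (rule fact_binomial_ge[OF that(2,1)])
  qed (use w z desc_le_n in \<open>auto simp: C_def D_def w_def[symmetric] z_def[symmetric]
        simp del: power_Suc intro!: binomial_shift_sums\<close>)
  have eq: "(\<Sum>\<sigma>\<in>?S n. C n \<sigma> * D n \<sigma>) / fact n =
      desc_mgf n (- s) t * (w * z ^ n / ((1 - w) ^ Suc n * (1 - z) ^ Suc n))" if "n \<ge> 1" for n
  proof -
    have "C n \<sigma> * D n \<sigma> = exp (- s * real (descents n \<sigma>) + t * real (descents n (inv \<sigma>))) *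
        (w * z ^ n / ((1 - w) ^ Suc n * (1 - z) ^ Suc n))" for \<sigma>
    proof -
      have e: "n - (n - 1 - descents n \<sigma>) = Suc (descents n \<sigma>)"
        using descents_le[of n \<sigma>] that by simp
      have p: "w ^ k = exp (- s * real k)" for k
        by (simp add: w_def mult.commute flip: exp_of_nat_mult)
      have q: "z ^ (n - descents n (inv \<sigma>)) = exp (t * real (descents n (inv \<sigma>))) * z ^ n"
        using desc_le_n[of n "inv \<sigma>"]
        by (simp add: z_def of_nat_diff algebra_simps flip: exp_of_nat_mult exp_add)
      show ?thesis unfolding C_def D_def e q power_Suc[of w "descents n \<sigma>"]
          p[of "descents n _"] exp_add by simp
    qed
    thus ?thesis by (simp only: desc_mgf_def times_divide_eq_left flip: sum_distrib_right)
  qed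
  have ln_eq: "ln ((\<Sum>\<sigma>\<in>?S n. C n \<sigma> * D n \<sigma>) / fact n) / real n + s / real n + t +
      (1 + 1 / real n) * (ln (1 - w) + ln (1 - z)) = ln (desc_mgf n (- s) t) / real n" if "n \<ge> 1" for n
  proof -
    have "ln ((\<Sum>\<sigma>\<in>?S n. C n \<sigma> * D n \<sigma>) / fact n) = ln (desc_mgf n (- s) t) +
       (ln w + real n * ln z - (real (Suc n) * ln (1 - w) + real (Suc n) * ln (1 - z)))"
      unfolding eq[OF that] using w z desc_mgf_pos[of n "- s" t]
      by (simp add: ln_mult ln_div ln_realpow del: power_Suc of_nat_Suc)
    moreover have "ln w = - s" "ln z = - t" by (simp_all add: w_def z_def)
    ultimately have "ln (desc_mgf n (- s) t) = ln ((\<Sum>\<sigma>\<in>?S n. C n \<sigma> * D n \<sigma>) / fact n) +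
        (s + real n * t) + (real n + 1) * (ln (1 - w) + ln (1 - z))"
      by (simp add: algebra_simps)
    moreover have "(1 + 1 / real n) * K = (real n + 1) * K / real n" for K
      using that by (simp add: field_simps)
    ultimately show ?thesis using that by (simp only: add_divide_distrib) simp
  qed
  have "(\<lambda>n. ln ((\<Sum>\<sigma>\<in>?S n. C n \<sigma> * D n \<sigma>) / fact n) / real n + s / real n + t +
      (1 + 1 / real n) * (ln (1 - w) + ln (1 - z)))
      \<longlonglongrightarrow> (- ln s - ln t) + 0 + t + (1 + 0) * (ln (1 - w) + ln (1 - z))"
    by (intro tendsto_add lim tendsto_mult tendsto_const lim_const_over_n lim_1_over_n)
  moreover have "(- ln s - ln t) + 0 + t + (1 + 0) * (ln (1 - w) + ln (1 - z)) = L (- s) + L t"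
    by (simp add: L_neg[OF s] L_pos[OF t] L_neg[OF t] w_def z_def)
  ultimately show ?thesis
    using ln_eq by (auto elim!: Lim_transform_eventually
        intro: eventually_mono[OF eventually_ge_at_top[of 1]])
qed

lemma desc_mgf_swap: "desc_mgf n s t = desc_mgf n t s"
proof -
  have "(\<Sum>\<sigma> | \<sigma> permutes {1..n}. exp (s * real (descents n \<sigma>) + t * real (descents n (inv \<sigma>)))) =
    (\<Sum>\<sigma> | \<sigma> permutes {1..n}. exp (s * real (descents n (inv \<sigma>)) + t * real (descents n (inv (inv \<sigma>)))))"
    by (rule sum_permutations_inverse)
  also have "\<dots> = (\<Sum>\<sigma> | \<sigma> permutes {1..n}. exp (t * real (descents n \<sigma>) + s * real (descents n (inv \<sigma>))))"
    by (intro sum.cong refl) (auto simp: permutes_inv_inv add.commute)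
  finally show ?thesis by (simp add: desc_mgf_def)
qed

text \<open>Composing with the reversal \<open>r\<close> on the right reverses the positions of
  \<open>\<sigma>\<close> and complements the values of \<open>inv \<sigma>\<close>. Both operations
  exchange ascents and descents.\<close>

lemma desc_mgf_reverse:
  assumes n: "n \<ge> 1"
  shows "desc_mgf n s t = exp ((s + t) * real (n - 1)) * desc_mgf n (- s) (- t)"
proof -
  define r where "r = (\<lambda>k. if k \<in> {1..n} then Suc n - k else k)"
  have rr: "r (r k) = k" for k by (auto simp: r_def)
  have r: "r permutes {1..n}"
    by (rule bij_imp_permutes) (auto intro!: bij_betwI[where g = r] simp: r_def)
  have inv_r: "inv r = r" using rr by (intro inv_equality) auto
  have desc1: "descents n (\<sigma> \<circ> r) = n - 1 - descents n \<sigma>" if \<sigma>: "\<sigma> permutes {1..n}" for \<sigma>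
  proof -
    have "bij_betw (\<lambda>i. n - i) {i \<in> {1..n - 1}. (\<sigma> \<circ> r) i > (\<sigma> \<circ> r) (i + 1)}
        ({m. \<sigma> m < \<sigma> (Suc m)} \<inter> {1..<n})"
      by (rule bij_betwI[where g = "\<lambda>i. n - i"]) (auto simp: r_def Suc_diff_le)
    from bij_betw_same_card[OF this] show ?thesis
      using card_ascents[OF n permutes_inj[OF \<sigma>]] by (simp add: descents_def)
  qed
  have desc2: "descents n (r \<circ> \<rho>) = n - 1 - descents n \<rho>" if \<rho>: "\<rho> permutes {1..n}" for \<rho>
  proof -
    have "{i \<in> {1..n - 1}. (r \<circ> \<rho>) i > (r \<circ> \<rho>) (i + 1)} = {m. \<rho> m < \<rho> (Suc m)} \<inter> {1..<n}"
    proof -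
      have "(r \<circ> \<rho>) i > (r \<circ> \<rho>) (i + 1) \<longleftrightarrow> \<rho> i < \<rho> (Suc i)" if "i \<in> {1..<n}" for i
        using permutes_in_image[OF \<rho>, of i] permutes_in_image[OF \<rho>, of "Suc i"] that
        by (auto simp: r_def)
      thus ?thesis using n by auto
    qed
    thus ?thesis using card_ascents[OF n permutes_inj[OF \<rho>]] by (simp add: descents_def)
  qed
  have "(\<Sum>\<sigma> | \<sigma> permutes {1..n}. exp (s * real (descents n \<sigma>) + t * real (descents n (inv \<sigma>)))) =
    (\<Sum>\<sigma> | \<sigma> permutes {1..n}. exp (s * real (descents n (\<sigma> \<circ> r)) + t * real (descents n (inv (\<sigma> \<circ> r)))))"
    by (rule sum_permutations_compose_right[OF r])
  also have "\<dots> = (\<Sum>\<sigma> | \<sigma> permutes {1..n}. exp ((s + t) * real (n - 1)) *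
      exp (- s * real (descents n \<sigma>) + - t * real (descents n (inv \<sigma>))))"
  proof (intro sum.cong refl)
    fix \<sigma> assume "\<sigma> \<in> {\<sigma>. \<sigma> permutes {1..n}}"
    hence \<sigma>: "\<sigma> permutes {1..n}" by simp
    have "inv (\<sigma> \<circ> r) = r \<circ> inv \<sigma>"
      using o_inv_distrib[OF permutes_bij[OF \<sigma>] permutes_bij[OF r]] inv_r by simp
    hence "descents n (inv (\<sigma> \<circ> r)) = n - 1 - descents n (inv \<sigma>)"
      using desc2[OF permutes_inv[OF \<sigma>]] by simp
    thus "exp (s * real (descents n (\<sigma> \<circ> r)) + t * real (descents n (inv (\<sigma> \<circ> r)))) =
      exp ((s + t) * real (n - 1)) * exp (- s * real (descents n \<sigma>) + - t * real (descents n (inv \<sigma>)))"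
      using descents_le[of n \<sigma>] descents_le[of n "inv \<sigma>"]
      by (simp only: desc1[OF \<sigma>] of_nat_diff flip: exp_add) (simp add: algebra_simps)
  qed
  finally show ?thesis by (simp add: desc_mgf_def sum_distrib_left)
qed

lemma desc_mgf_lim_pos_pos:
  assumes s: "s > 0" and t: "t > 0"
  shows "(\<lambda>n. ln (desc_mgf n s t) / real n) \<longlonglongrightarrow> L s + L t"
proof -
  have "(\<lambda>n. (s + t) - (s + t) / real n + ln (desc_mgf n (- s) (- t)) / real n)
      \<longlonglongrightarrow> (s + t) - 0 + (L (- s) + L (- t))"
    by (intro tendsto_add tendsto_diff tendsto_const lim_const_over_n desc_mgf_lim_neg_neg s t)
  moreover have "(s + t) - 0 + (L (- s) + L (- t)) = L s + L t"
    by (simp add: L_pos[OF s] L_pos[OF t])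
  moreover have "(s + t) - (s + t) / real n + ln (desc_mgf n (- s) (- t)) / real n =
      ln (desc_mgf n s t) / real n" if "n \<ge> 1" for n
    unfolding desc_mgf_reverse[OF that, of s t]
    using desc_mgf_pos[of n "- s" "- t"] that by (simp add: ln_mult field_simps of_nat_diff)
  ultimately show ?thesis
    by (auto elim!: Lim_transform_eventually
        intro: eventually_mono[OF eventually_ge_at_top[of 1]])
qed

lemma desc_mgf_lim_nonzero:
  assumes "s \<noteq> 0" "t \<noteq> 0"
  shows "(\<lambda>n. ln (desc_mgf n s t) / real n) \<longlonglongrightarrow> L s + L t"
proof -
  consider "s > 0" "t > 0" | "s < 0" "t > 0" | "s > 0" "t < 0" | "s < 0" "t < 0"
    using assms by linarith
  thus ?thesis
  proof cases
    case 1 thus ?thesis by (rule desc_mgf_lim_pos_pos)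
  next
    case 2 thus ?thesis using desc_mgf_lim_neg_pos[of "- s" t] by simp
  next
    case 3 thus ?thesis
      using desc_mgf_lim_neg_pos[of "- t" s] by (simp add: desc_mgf_swap[of _ s t] add.commute)
  next
    case 4 thus ?thesis using desc_mgf_lim_neg_neg[of "- s" "- t"] by simp
  qed
qed

lemma L_differentiable: "L differentiable (at t)"
proof (cases "t = 0")
  case True
  have "((\<lambda>h. (L (0 + h) - L 0) / h) \<longlongrightarrow> 1 / 2) (at 0)"
  proof (rule Lim_transform_eventually)
    show "((\<lambda>h::real. ln ((exp h - 1) / h) / h) \<longlongrightarrow> 1 / 2) (at 0)" by real_asymp
    show "\<forall>\<^sub>F h in at 0. ln ((exp h - 1) / h) / h = (L (0 + h) - L 0) / h"
      by (auto simp: eventually_at_filter L_def)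
  qed
  hence "(L has_field_derivative (1 / 2)) (at 0)" by (simp add: DERIV_def)
  thus ?thesis using True real_differentiable_def by blast
next
  case False
  have pos: "(exp t - 1) / t > 0" using False
    by (cases "t > 0") (auto simp: divide_pos_pos divide_neg_neg)
  have "((\<lambda>t. ln ((exp t - 1) / t)) has_field_derivative
      (1 / ((exp t - 1) / t) * ((exp t * t - (exp t - 1)) / (t * t)))) (at t)"
    using False pos by (auto intro!: derivative_eq_intros)
  hence "(L has_field_derivative (1 / ((exp t - 1) / t) * ((exp t * t - (exp t - 1)) / (t * t)))) (at t)"
  proof (rule DERIV_cong_ev[THEN iffD1, rotated -1])
    have "\<forall>\<^sub>F x in nhds t. x \<in> - {0}" using False by (intro eventually_nhds_in_open) auto
    thus "\<forall>\<^sub>F x in nhds t. ln ((exp x - 1) / x) = L x"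
      by eventually_elim (auto simp: L_def)
  qed auto
  thus ?thesis using real_differentiable_def by blast
qed

lemma L_isCont: "isCont L t"
  using L_differentiable differentiable_imp_continuous_within by blast

text \<open>The axes are reached by squeezing: both parameters move by the same small
  \<open>e\<close>, chosen so that neither becomes 0. The moment generating function is monotone in
  them, and continuity of \<open>L\<close> bounds the error.\<close>

lemma desc_mgf_lim: "(\<lambda>n. ln (desc_mgf n s t) / real n) \<longlonglongrightarrow> L s + L t"
proof (rule order_tendstoI)
  fix a assume a: "a < L s + L t"
  have "((\<lambda>e. L (s + e) + L (t + e)) \<longlongrightarrow> L (s + 0) + L (t + 0)) (at_left 0)"
    by (intro tendsto_add isCont_tendsto_compose[OF L_isCont] tendsto_intros)
  with a have "\<forall>\<^sub>F e in at_left 0. a < L (s + e) + L (t + e)" by (intro order_tendstoD) auto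
  moreover have "\<forall>\<^sub>F e in at_left 0. e \<noteq> - s" "\<forall>\<^sub>F e in at_left 0. e \<noteq> - t"
    by (rule eventually_neq_at_within)+
  moreover have "\<forall>\<^sub>F e in at_left (0::real). e < 0" by (simp add: eventually_at_filter)
  ultimately have "\<forall>\<^sub>F e in at_left 0. a < L (s + e) + L (t + e) \<and> s + e \<noteq> 0 \<and> t + e \<noteq> 0 \<and> e < 0"
    by eventually_elim auto
  then obtain e where e: "a < L (s + e) + L (t + e)" "s + e \<noteq> 0" "t + e \<noteq> 0" "e < 0"
    using eventually_happens'[OF trivial_limit_at_left_real] by blast
  show "\<forall>\<^sub>F n in sequentially. a < ln (desc_mgf n s t) / real n"
    using order_tendstoD(1)[OF desc_mgf_lim_nonzero[OF e(2,3)] e(1)]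
  proof eventually_elim
    case (elim n)
    have "ln (desc_mgf n (s + e) (t + e)) / real n \<le> ln (desc_mgf n s t) / real n"
      using e(4) by (intro divide_right_mono ln_mono desc_mgf_mono desc_mgf_pos) auto
    thus ?case using elim by linarith
  qed
next
  fix a assume a: "L s + L t < a"
  have "((\<lambda>e. L (s + e) + L (t + e)) \<longlongrightarrow> L (s + 0) + L (t + 0)) (at_right 0)"
    by (intro tendsto_add isCont_tendsto_compose[OF L_isCont] tendsto_intros)
  with a have "\<forall>\<^sub>F e in at_right 0. L (s + e) + L (t + e) < a" by (intro order_tendstoD) auto
  moreover have "\<forall>\<^sub>F e in at_right 0. e \<noteq> - s" "\<forall>\<^sub>F e in at_right 0. e \<noteq> - t"
    by (rule eventually_neq_at_within)+
  moreover have "\<forall>\<^sub>F e in at_right (0::real). 0 < e" by (simp add: eventually_at_filter)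
  ultimately have "\<forall>\<^sub>F e in at_right 0. L (s + e) + L (t + e) < a \<and> s + e \<noteq> 0 \<and> t + e \<noteq> 0 \<and> 0 < e"
    by eventually_elim auto
  then obtain e where e: "L (s + e) + L (t + e) < a" "s + e \<noteq> 0" "t + e \<noteq> 0" "0 < e"
    using eventually_happens'[OF trivial_limit_at_right_real] by blast
  show "\<forall>\<^sub>F n in sequentially. ln (desc_mgf n s t) / real n < a"
    using order_tendstoD(2)[OF desc_mgf_lim_nonzero[OF e(2,3)] e(1)]
  proof eventually_elim
    case (elim n)
    have "ln (desc_mgf n s t) / real n \<le> ln (desc_mgf n (s + e) (t + e)) / real n"
      using e(4) by (intro divide_right_mono ln_mono desc_mgf_mono desc_mgf_pos) auto
    thus ?case using elim by linarith
  qed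
qed

section \<open>The large deviation principle\<close>

definition desc_point :: "nat \<Rightarrow> (nat \<Rightarrow> nat) \<Rightarrow> real \<times> real" where
  "desc_point n \<sigma> = (real (descents n \<sigma>) / real n, real (descents n (inv \<sigma>)) / real n)"

definition desc_prob :: "nat \<Rightarrow> (real \<times> real) set \<Rightarrow> real" where
  "desc_prob n F = real (card {\<sigma>. \<sigma> permutes {1..n} \<and> desc_point n \<sigma> \<in> F}) / fact n"

lemma desc_mgf_altdef:
  assumes "n \<ge> 1"
  shows "desc_mgf n s t = (\<Sum>\<sigma> | \<sigma> permutes {1..n}.
     exp (real n * (s * fst (desc_point n \<sigma>) + t * snd (desc_point n \<sigma>)))) / fact n"
  using assms by (simp add: desc_mgf_def desc_point_def ring_distribs)

lemma desc_point_mem: "desc_point n \<sigma> \<in> {0..1} \<times> {0..1}"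
proof -
  have "real (descents n \<rho>) \<le> real n" for \<rho> using descents_le[of n \<rho>] by simp
  thus ?thesis by (auto simp: desc_point_def divide_le_eq_1)
qed

text \<open>Exponential Chebyshev under the weight with parameters \<open>s\<close> and
  \<open>t\<close>: on \<open>A\<close> the further tilt by \<open>p\<close> and \<open>q\<close> is
  at least exp (n c). With \<open>s = t = 0\<close> it bounds probabilities, and for general
  \<open>s\<close>, \<open>t\<close> it bounds tails of the tilted law.\<close>

lemma tilted_sum_le:
  assumes n: "n \<ge> 1" and A: "A \<subseteq> {\<sigma>. \<sigma> permutes {1..n}}"
    and c: "\<And>\<sigma>. \<sigma> \<in> A \<Longrightarrow> c \<le> p * fst (desc_point n \<sigma>) + q * snd (desc_point n \<sigma>)"
  shows "(\<Sum>\<sigma>\<in>A. exp (real n * (s * fst (desc_point n \<sigma>) + t * snd (desc_point n \<sigma>)))) / fact n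
    \<le> exp (- real n * c) * desc_mgf n (s + p) (t + q)"
proof -
  have "(\<Sum>\<sigma>\<in>A. exp (real n * (s * fst (desc_point n \<sigma>) + t * snd (desc_point n \<sigma>)))) \<le>
     (\<Sum>\<sigma>\<in>A. exp (- real n * c) * exp (real n * ((s + p) * fst (desc_point n \<sigma>) + (t + q) * snd (desc_point n \<sigma>))))"
  proof (rule sum_mono)
    fix \<sigma> assume "\<sigma> \<in> A"
    hence "real n * c \<le> real n * (p * fst (desc_point n \<sigma>) + q * snd (desc_point n \<sigma>))"
      using c by (intro mult_left_mono) auto
    thus "exp (real n * (s * fst (desc_point n \<sigma>) + t * snd (desc_point n \<sigma>))) \<le>
      exp (- real n * c) * exp (real n * ((s + p) * fst (desc_point n \<sigma>) + (t + q) * snd (desc_point n \<sigma>)))"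
      by (simp add: algebra_simps flip: exp_add)
  qed
  also have "\<dots> \<le> (\<Sum>\<sigma> | \<sigma> permutes {1..n}. exp (- real n * c) *
      exp (real n * ((s + p) * fst (desc_point n \<sigma>) + (t + q) * snd (desc_point n \<sigma>))))"
    using A by (intro sum_mono2) (auto simp: finite_permutations)
  finally show ?thesis
    unfolding desc_mgf_altdef[OF n] times_divide_eq_right sum_distrib_left
    by (intro divide_right_mono) auto
qed

lemma desc_prob_halfplane_le:
  assumes "n \<ge> 1" "H \<subseteq> {u. c \<le> p * fst u + q * snd u}"
  shows "desc_prob n H \<le> exp (- real n * c) * desc_mgf n p q"
  using tilted_sum_le[of n "{\<sigma>. \<sigma> permutes {1..n} \<and> desc_point n \<sigma> \<in> H}" c p q 0 0] assms
  by (auto simp: desc_prob_def)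

lemma desc_prob_nonneg: "0 \<le> desc_prob n F"
  by (simp add: desc_prob_def)

lemma eventually_desc_mgf_le:
  assumes "L s + L t < a"
  shows "\<forall>\<^sub>F n in sequentially. desc_mgf n s t \<le> exp (real n * a)"
  using order_tendstoD(2)[OF desc_mgf_lim assms] eventually_ge_at_top[of 1]
proof eventually_elim
  case (elim n)
  hence "ln (desc_mgf n s t) \<le> real n * a" by (simp add: field_simps)
  thus ?case using desc_mgf_pos[of n s t] by (metis exp_le_cancel_iff exp_ln)
qed

lemma eventually_desc_mgf_ge:
  assumes "a < L s + L t"
  shows "\<forall>\<^sub>F n in sequentially. exp (real n * a) \<le> desc_mgf n s t"
  using order_tendstoD(1)[OF desc_mgf_lim assms] eventually_ge_at_top[of 1]
proof eventually_elim
  case (elim n)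
  hence "real n * a \<le> ln (desc_mgf n s t)" by (simp add: field_simps)
  thus ?case using desc_mgf_pos[of n s t] by (metis exp_le_cancel_iff exp_ln)
qed

lemma eventually_const_le_exp:
  fixes C a b :: real
  assumes "a < b"
  shows "\<forall>\<^sub>F n in sequentially. C * exp (real n * a) \<le> exp (real n * b)"
proof -
  have "filterlim (\<lambda>n. exp (real n * (b - a))) at_top sequentially"
    using assms by real_asymp
  hence "\<forall>\<^sub>F n in sequentially. C \<le> exp (real n * (b - a))"
    by (simp add: filterlim_at_top)
  thus ?thesis
  proof eventually_elim
    case (elim n)
    hence "C * exp (real n * a) \<le> exp (real n * (b - a)) * exp (real n * a)"
      by (intro mult_right_mono) auto
    thus ?case by (simp add: algebra_simps flip: exp_add)
  qed
qed

section \<open>Lower bound by exponential tilting\<close>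

text \<open>The hypothesis says that the Chebyshev bound for a half plane grows at a strictly
  smaller rate than the total tilted mass. One fifth is chosen so that four such half planes still
  leave a fifth of the mass.\<close>

lemma eventually_tail_negligible:
  assumes "L (s + p) + L (t + q) - c < L s + L t"
  shows "\<forall>\<^sub>F n in sequentially. exp (- real n * c) * desc_mgf n (s + p) (t + q) \<le> desc_mgf n s t / 5"
proof -
  obtain a where a: "L (s + p) + L (t + q) - c < a" "a < L s + L t"
    using dense[OF assms] by blast
  obtain b where b: "a < b" "b < L s + L t" using dense[OF a(2)] by blast
  have "L (s + p) + L (t + q) < a + c" using a(1) by linarith
  from eventually_desc_mgf_le[OF this] eventually_desc_mgf_ge[OF b(2)]
    eventually_const_le_exp[OF b(1), of 5]
  show ?thesis
  proof eventually_elim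
    case (elim n)
    have "exp (- real n * c) * desc_mgf n (s + p) (t + q) \<le> exp (- real n * c) * exp (real n * (a + c))"
      using elim(1) by (intro mult_left_mono) auto
    also have "\<dots> = exp (real n * a)" by (simp add: algebra_simps flip: exp_add)
    finally show ?case using elim by linarith
  qed
qed

text \<open>A small step \<open>\<theta>\<close> to either side keeps the difference quotient within
  \<delta> of the derivative. These inequalities are the hypotheses of
  \<open>eventually_tail_negligible\<close> for deviations of size \<delta> above and below
  \<open>x\<close>.\<close>

lemma deriv_gap:
  fixes f :: "real \<Rightarrow> real"
  assumes "(f has_real_derivative x) (at s)" "\<delta> > 0"
  obtains \<theta> where "\<theta> > 0" "f (s + \<theta>) < f s + \<theta> * (x + \<delta>)" "f (s - \<theta>) < f s - \<theta> * (x - \<delta>)"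
proof -
  have lim: "((\<lambda>h. (f (s + h) - f s) / h) \<longlongrightarrow> x) (at 0)" using assms(1) by (simp add: DERIV_def)
  have "\<forall>\<^sub>F h in at 0. (f (s + h) - f s) / h < x + \<delta> \<and> x - \<delta> < (f (s + h) - f s) / h"
    using order_tendstoD[OF lim] assms(2) by (intro eventually_conj) auto
  then obtain d where d: "d > 0"
    "\<And>h. h \<noteq> 0 \<Longrightarrow> dist h 0 < d \<Longrightarrow> (f (s + h) - f s) / h < x + \<delta> \<and> x - \<delta> < (f (s + h) - f s) / h"
    unfolding eventually_at by auto
  from d(2)[of "d / 2"] d(2)[of "- (d / 2)"] d(1) show ?thesis
    by (intro that[of "d / 2"]) (auto simp: field_simps)
qed

text \<open>Under the weight exp (n (s X + t Y)) the point (X, Y) concentrates at the gradient of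
  the limiting cumulant generating function, which is \<open>(x, y)\<close>. A small box around it
  therefore keeps a fixed share of the tilted mass, and on that box the weight is almost constant
  and can be divided out.\<close>

lemma desc_prob_ge:
  assumes G: "open G" "(x, y) \<in> G"
    and s: "(L has_real_derivative x) (at s)" and t: "(L has_real_derivative y) (at t)"
    and a: "a < L s + L t - s * x - t * y"
  shows "\<forall>\<^sub>F n in sequentially. exp (real n * a) \<le> desc_prob n G"
proof -
  define \<Lambda> where "\<Lambda> = L s + L t"
  define K where "K = \<bar>s\<bar> + \<bar>t\<bar> + 1"
  have K: "K > 0" by (simp add: K_def)
  \<comment> \<open>Half of the slack in \<open>a\<close>: one \<open>g\<close> absorbs the factor 5
    and the error in the rate, the other the variation of the weight over the box.\<close>
  define g where "g = (\<Lambda> - s * x - t * y - a) / 2"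
  have g: "g > 0" using a by (simp add: g_def \<Lambda>_def)
  obtain e where e: "e > 0" "ball (x, y) e \<subseteq> G" using G open_contains_ball by blast
  \<comment> \<open>The bound e / 2 keeps the box inside the ball of radius \<open>e\<close>, and g
    / K keeps \<open>s * X + t * Y\<close> within \<open>g\<close> of its value at
    \<open>(x, y)\<close>.\<close>
  define \<delta> where "\<delta> = min (e / 2) (g / K)"
  have \<delta>: "\<delta> > 0" "\<delta> \<le> e / 2" "\<delta> * K \<le> g"
    using e g K by (auto simp: \<delta>_def min_def field_simps)
  have box: "u \<in> G" if "\<bar>fst u - x\<bar> < \<delta>" "\<bar>snd u - y\<bar> < \<delta>" for u
  proof -
    have "dist (x, y) u \<le> dist x (fst u) + dist y (snd u)"
      unfolding dist_prod_def by (simp add: sqrt_sum_squares_le_sum)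
    also have "\<dots> < e" using that \<delta> by (simp add: dist_real_def abs_minus_commute)
    finally show ?thesis using e(2) by (auto simp: mem_ball)
  qed
  obtain \<theta> where \<theta>: "\<theta> > 0" "L (s + \<theta>) < L s + \<theta> * (x + \<delta>)" "L (s - \<theta>) < L s - \<theta> * (x - \<delta>)"
    using deriv_gap[OF s \<delta>(1)] .
  obtain \<phi> where \<phi>: "\<phi> > 0" "L (t + \<phi>) < L t + \<phi> * (y + \<delta>)" "L (t - \<phi>) < L t - \<phi> * (y - \<delta>)"
    using deriv_gap[OF t \<delta>(1)] .
  have b: "\<Lambda> - g < \<Lambda>" using g by simp
  obtain b where b: "\<Lambda> - g < b" "b < \<Lambda>" using dense[OF b] by blast
  from eventually_tail_negligible[of s \<theta> t 0 "\<theta> * (x + \<delta>)"]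
    eventually_tail_negligible[of s "- \<theta>" t 0 "- \<theta> * (x - \<delta>)"]
    eventually_tail_negligible[of s 0 t \<phi> "\<phi> * (y + \<delta>)"]
    eventually_tail_negligible[of s 0 t "- \<phi>" "- \<phi> * (y - \<delta>)"] \<theta> \<phi>
  have "\<forall>\<^sub>F n in sequentially. exp (- real n * (\<theta> * (x + \<delta>))) * desc_mgf n (s + \<theta>) (t + 0) \<le> desc_mgf n s t / 5"
    "\<forall>\<^sub>F n in sequentially. exp (- real n * (- \<theta> * (x - \<delta>))) * desc_mgf n (s + - \<theta>) (t + 0) \<le> desc_mgf n s t / 5"
    "\<forall>\<^sub>F n in sequentially. exp (- real n * (\<phi> * (y + \<delta>))) * desc_mgf n (s + 0) (t + \<phi>) \<le> desc_mgf n s t / 5"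
    "\<forall>\<^sub>F n in sequentially. exp (- real n * (- \<phi> * (y - \<delta>))) * desc_mgf n (s + 0) (t + - \<phi>) \<le> desc_mgf n s t / 5"
    by auto
  moreover have "\<forall>\<^sub>F n in sequentially. exp (real n * b) \<le> desc_mgf n s t"
    using b(2) by (intro eventually_desc_mgf_ge) (simp add: \<Lambda>_def)
  moreover have "\<forall>\<^sub>F n in sequentially. 5 * exp (real n * (\<Lambda> - g)) \<le> exp (real n * b)"
    by (rule eventually_const_le_exp[OF b(1)])
  ultimately show ?thesis using eventually_ge_at_top[of 1]
  proof eventually_elim
    case (elim n)
    note n = elim(7)
    let ?S = "{\<sigma>. \<sigma> permutes {1..n}}"
    let ?X = "\<lambda>\<sigma>. fst (desc_point n \<sigma>)" and ?Y = "\<lambda>\<sigma>. snd (desc_point n \<sigma>)"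
    let ?e = "\<lambda>\<sigma>. exp (real n * (s * ?X \<sigma> + t * ?Y \<sigma>))"
    have fin: "finite ?S" by (simp add: finite_permutations)
    define A where "A = {\<sigma>\<in>?S. desc_point n \<sigma> \<in> G}"
    define B1 where "B1 = {\<sigma>\<in>?S. x + \<delta> \<le> ?X \<sigma>}"
    define B2 where "B2 = {\<sigma>\<in>?S. ?X \<sigma> \<le> x - \<delta>}"
    define B3 where "B3 = {\<sigma>\<in>?S. y + \<delta> \<le> ?Y \<sigma>}"
    define B4 where "B4 = {\<sigma>\<in>?S. ?Y \<sigma> \<le> y - \<delta>}"
    define A0 where "A0 = ?S - (B1 \<union> B2 \<union> B3 \<union> B4)"
    have A0: "\<bar>?X \<sigma> - x\<bar> < \<delta>" "\<bar>?Y \<sigma> - y\<bar> < \<delta>" if "\<sigma> \<in> A0" for \<sigma>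
      using that unfolding A0_def B1_def B2_def B3_def B4_def by (auto simp: abs_less_iff)
    have A0A: "A0 \<subseteq> A"
    proof
      fix \<sigma> assume "\<sigma> \<in> A0"
      thus "\<sigma> \<in> A" using box[OF A0, of \<sigma>] by (simp add: A_def A0_def)
    qed
    have B1: "sum ?e B1 / fact n \<le> desc_mgf n s t / 5"
      by (rule order.trans[OF tilted_sum_le[OF n, of _ "\<theta> * (x + \<delta>)" \<theta> 0] elim(1)])
        (use \<theta>(1) in \<open>auto simp: B1_def\<close>)
    have B2: "sum ?e B2 / fact n \<le> desc_mgf n s t / 5"
      by (rule order.trans[OF tilted_sum_le[OF n, of _ "- \<theta> * (x - \<delta>)" "- \<theta>" 0] elim(2)])
        (use \<theta>(1) in \<open>auto simp: B2_def\<close>)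
    have B3: "sum ?e B3 / fact n \<le> desc_mgf n s t / 5"
      by (rule order.trans[OF tilted_sum_le[OF n, of _ "\<phi> * (y + \<delta>)" 0 \<phi>] elim(3)])
        (use \<phi>(1) in \<open>auto simp: B3_def\<close>)
    have B4: "sum ?e B4 / fact n \<le> desc_mgf n s t / 5"
      by (rule order.trans[OF tilted_sum_le[OF n, of _ "- \<phi> * (y - \<delta>)" 0 "- \<phi>"] elim(4)])
        (use \<phi>(1) in \<open>auto simp: B4_def\<close>)
    have fins: "finite A0" "finite B1" "finite B2" "finite B3" "finite B4"
      using fin by (auto simp: A0_def B1_def B2_def B3_def B4_def)
    have un: "sum ?e (C \<union> D) \<le> sum ?e C + sum ?e D" if "finite C" "finite D" for C D
      using sum.union_inter[OF that, of ?e] sum_nonneg[of "C \<inter> D" ?e] by simp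
    have "sum ?e ?S \<le> sum ?e (A0 \<union> (B1 \<union> (B2 \<union> (B3 \<union> B4))))"
      using fins by (intro sum_mono2) (auto simp: A0_def)
    also have "\<dots> \<le> sum ?e A0 + (sum ?e B1 + (sum ?e B2 + (sum ?e B3 + sum ?e B4)))"
      using un[of A0 "B1 \<union> (B2 \<union> (B3 \<union> B4))"] un[of B1 "B2 \<union> (B3 \<union> B4)"]
        un[of B2 "B3 \<union> B4"] un[of B3 B4] fins by simp
    finally have "sum ?e ?S / fact n \<le>
        (sum ?e A0 + (sum ?e B1 + (sum ?e B2 + (sum ?e B3 + sum ?e B4)))) / fact n"
      by (intro divide_right_mono) auto
    \<comment> \<open>The four half planes cover the complement of the box and carry at most four
      fifths of the tilted mass.\<close>
    hence "desc_mgf n s t / 5 \<le> sum ?e A0 / fact n"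
    proof -
      have "m / 5 \<le> a0" if "m \<le> a0 + (b1 + (b2 + (b3 + b4)))" "b1 \<le> m / 5" "b2 \<le> m / 5"
        "b3 \<le> m / 5" "b4 \<le> m / 5" for m a0 b1 b2 b3 b4 :: real
        using that by simp
      moreover assume "sum ?e ?S / fact n \<le>
        (sum ?e A0 + (sum ?e B1 + (sum ?e B2 + (sum ?e B3 + sum ?e B4)))) / fact n"
      ultimately show ?thesis
        using B1 B2 B3 B4 unfolding desc_mgf_altdef[OF n] add_divide_distrib by blast
    qed
    also have "sum ?e A0 \<le> (\<Sum>\<sigma>\<in>A0. exp (real n * (s * x + t * y + g)))"
    proof (rule sum_mono)
      fix \<sigma> assume \<sigma>: "\<sigma> \<in> A0"
      have "s * (?X \<sigma> - x) \<le> \<bar>s\<bar> * \<delta>"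
        using A0(1)[OF \<sigma>] by (metis abs_ge_self abs_ge_zero abs_mult less_imp_le mult_left_mono order.trans)
      moreover have "t * (?Y \<sigma> - y) \<le> \<bar>t\<bar> * \<delta>"
        using A0(2)[OF \<sigma>] by (metis abs_ge_self abs_ge_zero abs_mult less_imp_le mult_left_mono order.trans)
      moreover have "\<bar>s\<bar> * \<delta> + \<bar>t\<bar> * \<delta> \<le> g"
        using \<delta>(1,3) by (simp add: K_def algebra_simps)
      ultimately have "s * ?X \<sigma> + t * ?Y \<sigma> \<le> s * x + t * y + g" by (simp add: algebra_simps)
      thus "?e \<sigma> \<le> exp (real n * (s * x + t * y + g))" by (simp add: mult_left_mono)
    qed
    also have "\<dots> \<le> real (card A) * exp (real n * (s * x + t * y + g))"
      using A0A fin by (auto simp: A_def intro!: card_mono)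
    finally have "desc_mgf n s t / 5 \<le> desc_prob n G * exp (real n * (s * x + t * y + g))"
      by (simp add: desc_prob_def A_def divide_right_mono)
    hence "exp (real n * (\<Lambda> - g)) \<le> desc_prob n G * exp (real n * (s * x + t * y + g))"
      using elim(5,6) by linarith
    hence "exp (real n * (\<Lambda> - g)) * exp (- (real n * (s * x + t * y + g))) \<le> desc_prob n G"
      by (simp add: exp_minus pos_divide_le_eq flip: divide_inverse)
    moreover have "exp (real n * (\<Lambda> - g)) * exp (- (real n * (s * x + t * y + g))) = exp (real n * a)"
    proof -
      have "2 * g = \<Lambda> - s * x - t * y - a" by (simp only: g_def) simp
      hence "\<Lambda> - s * x - t * y - 2 * g = a" by linarith
      moreover have "real n * (\<Lambda> - g) + - (real n * (s * x + t * y + g)) =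
          real n * (\<Lambda> - s * x - t * y - 2 * g)"
        by (simp add: algebra_simps)
      ultimately show ?thesis by (simp flip: exp_add)
    qed
    ultimately show ?case by simp
  qed
qed

text \<open>The function x t - L t tends to minus infinity on both sides, because \<open>L t\<close>
  behaves like t - ln t at plus infinity and like - ln (- t) at minus infinity. So it has an
  interior maximum, where its derivative vanishes.\<close>

lemma L_has_derivative_exists:
  assumes x: "0 < x" "x < 1"
  shows "\<exists>s. (L has_real_derivative x) (at s)"
proof -
  define h where "h = (\<lambda>t. x * t - L t)"
  have h0: "h 0 = 0" by (simp add: h_def L_def)
  have diff: "h differentiable (at t)" for t
    unfolding h_def using L_differentiable by (auto intro!: derivative_intros)
  have cont: "continuous_on A h" for A
    using diff by (auto intro!: continuous_at_imp_continuous_on differentiable_imp_continuous_within)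
  have "filterlim (\<lambda>t::real. x * t - (t + (ln (1 - exp (- t)) - ln t))) at_bot at_top"
    using x by real_asymp
  hence "\<forall>\<^sub>F t in at_top. x * t - (t + (ln (1 - exp (- t)) - ln t)) < 0"
    unfolding filterlim_at_bot_dense by blast
  hence "\<forall>\<^sub>F t in at_top. h t < 0" using eventually_gt_at_top[of 0]
    by eventually_elim (simp add: h_def L_pos L_neg)
  then obtain b where b: "b > 0" "h b < 0"
    using eventually_happens[OF eventually_conj[OF _ eventually_gt_at_top[of "0::real"]]] by auto
  have "filterlim (\<lambda>t::real. - (x * t) - (ln (1 - exp (- t)) - ln t)) at_bot at_top"
    using x by real_asymp
  hence "\<forall>\<^sub>F t in at_top. - (x * t) - (ln (1 - exp (- t)) - ln t) < 0"
    unfolding filterlim_at_bot_dense by blast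
  hence "\<forall>\<^sub>F t in at_top. h (- t) < 0" using eventually_gt_at_top[of 0]
    by eventually_elim (simp add: h_def L_neg)
  then obtain a where a: "a > 0" "h (- a) < 0"
    using eventually_happens[OF eventually_conj[OF _ eventually_gt_at_top[of "0::real"]]] by auto
  obtain s where s: "s \<in> {- a..b}" "\<And>t. t \<in> {- a..b} \<Longrightarrow> h t \<le> h s"
    using continuous_attains_sup[of "{- a..b}" h] cont a b by force
  \<comment> \<open>The value 0 at \<open>t = 0\<close> exceeds \<open>h\<close> at both end points,
    so the maximum is not attained there.\<close>
  have "h s \<ge> 0" using s(2)[of 0] a b h0 by simp
  hence s': "- a < s" "s < b" using s(1) a b by (auto simp: less_le)
  obtain D where D: "(h has_real_derivative D) (at s)"
    using diff real_differentiable_def by blast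
  have "D = 0"
  proof (rule DERIV_local_max[OF D])
    show "0 < min (b - s) (s + a)" using s' by simp
    show "\<forall>t. \<bar>s - t\<bar> < min (b - s) (s + a) \<longrightarrow> h t \<le> h s"
      using s(2) by (auto simp: abs_if split: if_splits)
  qed
  hence "((\<lambda>t. x * t - h t) has_real_derivative (x - 0)) (at s)"
    using DERIV_diff[OF DERIV_cmult_Id[of x] D] by simp
  thus ?thesis by (auto simp: h_def)
qed

section \<open>The rate function\<close>

text \<open>Even at the end points 0 and 1 the rate is infinite, since \<open>L t\<close> falls
  below max 0 t by about ln \<bar>t\<bar>. The witnesses \<open>- exp a\<close> and
  \<open>exp a\<close> make this gap at least \<open>a\<close>.\<close>

lemma rate_eq_top:
  assumes "x \<le> 0 \<or> 1 \<le> x"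
  shows "rate x = \<infinity>"
proof -
  have L_le: "L (- b) \<le> - ln b" if "b > 0" for b using that by (simp add: L_neg)
  have "\<exists>t. a \<le> x * t - L t" for a
  proof (cases "x \<le> 0")
    case True
    have "a \<le> x * (- exp a) - L (- exp a)"
      using L_le[of "exp a"] mult_nonpos_nonneg[OF True, of "exp a"] by simp
    thus ?thesis by blast
  next
    case False
    have "exp a \<le> x * exp a" using False assms by simp
    moreover have "L (- exp a) \<le> - a" "L (exp a) = exp a + L (- exp a)"
      using L_le[of "exp a"] L_pos[of "exp a"] by simp_all
    ultimately have "a \<le> x * exp a - L (exp a)" by linarith
    thus ?thesis by blast
  qed
  hence "ereal a \<le> rate x" for a
    unfolding rate_def by (metis SUP_upper2 UNIV_I ereal_less_eq(3))
  thus ?thesis by (rule ereal_top)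
qed

lemma rate_nonneg: "0 \<le> rate x"
  unfolding rate_def by (rule SUP_upper2[of 0]) (auto simp: L_def)

lemma rate_ge: "ereal (x * t - L t) \<le> rate x"
  unfolding rate_def by (rule SUP_upper) simp

text \<open>Turns sublevel sets of the joint rate into intersections of half planes over the reals.
  Nonnegativity of \<open>rate\<close> keeps the extended sum free of opposite infinities.\<close>

lemma rate_add_le_iff:
  "rate x + rate y \<le> ereal a \<longleftrightarrow> (\<forall>s t. (x * s - L s) + (y * t - L t) \<le> a)"
proof
  assume *: "rate x + rate y \<le> ereal a"
  show "\<forall>s t. (x * s - L s) + (y * t - L t) \<le> a"
  proof (intro allI)
    fix s t
    have "ereal (x * s - L s) + ereal (y * t - L t) \<le> rate x + rate y"
      by (intro add_mono rate_ge)
    hence "ereal (x * s - L s) + ereal (y * t - L t) \<le> ereal a" using * by (rule order.trans)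
    thus "(x * s - L s) + (y * t - L t) \<le> a" by simp
  qed
next
  assume *: "\<forall>s t. (x * s - L s) + (y * t - L t) \<le> a"
  have x: "rate x \<le> ereal (a - (y * t - L t))" for t
    unfolding rate_def using * by (intro SUP_least) (simp add: algebra_simps)
  have "rate x \<noteq> \<infinity>" "rate x \<noteq> - \<infinity>" using x[of 0] rate_nonneg[of x] by auto
  then obtain r where r: "rate x = ereal r" by (cases "rate x") auto
  have "y * t - L t \<le> a - r" for t using x[of t] unfolding r by simp
  hence "rate y \<le> ereal (a - r)" unfolding rate_def by (intro SUP_least) simp
  hence "rate x + rate y \<le> ereal r + ereal (a - r)" unfolding r by (rule add_left_mono)
  thus "rate x + rate y \<le> ereal a" by simp
qed

abbreviation (input) joint_rate :: "real \<times> real \<Rightarrow> ereal" where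
  "joint_rate \<equiv> \<lambda>(x, y). rate x + rate y"

lemma closed_joint_rate_sublevel: "closed {u. joint_rate u \<le> ereal a}"
proof -
  have "{u. joint_rate u \<le> ereal a} =
      (\<Inter>s. \<Inter>t. {u. (fst u * s - L s) + (snd u * t - L t) \<le> a})"
    by (auto simp: rate_add_le_iff)
  thus ?thesis by (auto intro!: closed_INT closed_Collect_le continuous_intros)
qed

lemma good_joint_rate: "good_rate_function joint_rate"
proof -
  have "{u. joint_rate u \<le> ereal a} \<subseteq> {0..1} \<times> {0..1}" for a
  proof
    fix u assume u: "u \<in> {u. joint_rate u \<le> ereal a}"
    obtain x y where xy: "u = (x, y)" by fastforce
    have *: "rate x + rate y \<le> ereal a" using u xy by simp
    have "rate x \<noteq> \<infinity>" "rate y \<noteq> \<infinity>"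
      using * rate_nonneg[of x] rate_nonneg[of y] by auto
    hence "0 < x" "x < 1" "0 < y" "y < 1" using rate_eq_top[of x] rate_eq_top[of y] by (auto intro: ccontr)
    thus "u \<in> {0..1} \<times> {0..1}" by (simp add: xy)
  qed
  hence "compact {u. joint_rate u \<le> ereal a}" for a
    using compact_Int_closed[OF compact_Times[OF compact_Icc compact_Icc] closed_joint_rate_sublevel]
    by (metis Int_absorb1)
  thus ?thesis
    by (auto simp: good_rate_function_def rate_function_def closed_joint_rate_sublevel
        intro!: add_nonneg_nonneg rate_nonneg)
qed

section \<open>Both bounds of the large deviation principle\<close>

text \<open>All values of \<open>desc_point\<close> lie in the unit square, so only the compact part
  of \<open>F\<close> inside it matters. Finitely many open half planes \<open>U (s, t)\<close>
  cover that part, and the exponential Chebyshev bound applies to each.\<close>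

lemma desc_prob_le:
  assumes F: "closed F" and c: "ereal c < (INF u\<in>F. joint_rate u)"
  shows "\<forall>\<^sub>F n in sequentially. desc_prob n F \<le> exp (- real n * c)"
proof -
  obtain c' where c': "ereal c < ereal c'" "ereal c' < (INF u\<in>F. joint_rate u)"
    using ereal_dense2[OF c] by blast
  define U where "U = (\<lambda>(s, t). {u. c' + L s + L t < fst u * s + snd u * t})"
  have cover: "F \<inter> ({0..1} \<times> {0..1}) \<subseteq> (\<Union>p\<in>UNIV. U p)"
  proof
    fix u assume "u \<in> F \<inter> ({0..1} \<times> {0..1})"
    hence "ereal c' < joint_rate u" using c'(2) less_INF_D by fastforce
    hence "\<not> rate (fst u) + rate (snd u) \<le> ereal c'" by (simp add: case_prod_beta not_le)
    then obtain s t where "\<not> (fst u * s - L s) + (snd u * t - L t) \<le> c'"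
      unfolding rate_add_le_iff by blast
    hence "u \<in> U (s, t)" by (simp add: U_def)
    thus "u \<in> (\<Union>p\<in>UNIV. U p)" by blast
  qed
  have "compact (F \<inter> ({0..1} \<times> {0..1}))"
    using F by (intro closed_Int_compact compact_Times compact_Icc)
  moreover have "open (U p)" for p
    unfolding U_def case_prod_beta by (intro open_Collect_less continuous_intros)
  ultimately obtain \<Phi> where \<Phi>: "finite \<Phi>" "F \<inter> ({0..1} \<times> {0..1}) \<subseteq> (\<Union>p\<in>\<Phi>. U p)"
    using cover by (metis compactE_image)
  \<comment> \<open>The gap from \<open>d\<close> to \<open>c'\<close> absorbs the error in the
    limit of \<open>desc_mgf\<close>, the gap from \<open>c\<close> to \<open>d\<close> the number
    of half planes.\<close>
  obtain d where d: "c < d" "d < c'" using c'(1) dense[of c c'] by auto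
  have "\<forall>\<^sub>F n in sequentially. \<forall>p\<in>\<Phi>. desc_mgf n (fst p) (snd p) \<le> exp (real n * (L (fst p) + L (snd p) + c' - d))"
    using d by (intro eventually_ball_finite \<Phi>(1) ballI eventually_desc_mgf_le) auto
  moreover have "\<forall>\<^sub>F n in sequentially. real (card \<Phi>) * exp (real n * - d) \<le> exp (real n * - c)"
    using d by (intro eventually_const_le_exp) auto
  ultimately show ?thesis using eventually_ge_at_top[of 1]
  proof eventually_elim
    case (elim n)
    let ?A = "\<lambda>F. {\<sigma>. \<sigma> permutes {1..n} \<and> desc_point n \<sigma> \<in> F}"
    have fin: "finite (?A F)" for F
      by (rule finite_subset[OF _ finite_permutations[of "{1..n}"]]) auto
    have "card (?A F) \<le> card (\<Union>p\<in>\<Phi>. ?A (U p))"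
      using \<Phi> desc_point_mem fin by (intro card_mono) blast+
    also have "\<dots> \<le> (\<Sum>p\<in>\<Phi>. card (?A (U p)))" by (rule card_UN_le[OF \<Phi>(1)])
    finally have "real (card (?A F)) \<le> (\<Sum>p\<in>\<Phi>. real (card (?A (U p))))"
      by (simp flip: of_nat_sum)
    hence "desc_prob n F \<le> (\<Sum>p\<in>\<Phi>. desc_prob n (U p))"
      unfolding desc_prob_def sum_divide_distrib[symmetric] by (intro divide_right_mono) auto
    also have "\<dots> \<le> (\<Sum>p\<in>\<Phi>. exp (real n * - d))"
    proof (rule sum_mono)
      fix p assume p: "p \<in> \<Phi>"
      let ?l = "L (fst p) + L (snd p)"
      have "desc_prob n (U p) \<le> exp (- real n * (c' + ?l)) * desc_mgf n (fst p) (snd p)"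
        by (rule desc_prob_halfplane_le[OF elim(3)]) (auto simp: U_def mult.commute)
      also have "\<dots> \<le> exp (- real n * (c' + ?l)) * exp (real n * (?l + c' - d))"
        using elim(1) p by (intro mult_left_mono) auto
      also have "\<dots> = exp (real n * - d)" by (simp add: algebra_simps flip: exp_add)
      finally show "desc_prob n (U p) \<le> exp (real n * - d)" .
    qed
    also have "\<dots> \<le> exp (- real n * c)" using elim(2) by simp
    finally show ?case .
  qed
qed

lemma LDP_upper:
  assumes F: "closed F"
  shows "limsup (\<lambda>n. ereal (1 / real n) * elog (desc_prob n F)) \<le> - (INF u\<in>F. joint_rate u)"
proof (rule ccontr)
  assume "\<not> ?thesis"
  hence lt: "- (INF u\<in>F. joint_rate u) < limsup (\<lambda>n. ereal (1 / real n) * elog (desc_prob n F))"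
    by (simp only: not_le)
  obtain r where r: "- (INF u\<in>F. joint_rate u) < ereal r"
    "ereal r < limsup (\<lambda>n. ereal (1 / real n) * elog (desc_prob n F))"
    using ereal_dense2[OF lt] by blast
  have "ereal (- r) < (INF u\<in>F. joint_rate u)"
    using r(1) by (simp add: ereal_uminus_less_reorder)
  from desc_prob_le[OF F this] eventually_ge_at_top[of 1]
  have "\<forall>\<^sub>F n in sequentially. ereal (1 / real n) * elog (desc_prob n F) \<le> ereal r"
  proof eventually_elim
    case (elim n)
    show ?case
    proof (cases "desc_prob n F = 0")
      case True
      \<comment> \<open>For \<open>n \<ge> 1\<close> the factor 1 / n is positive, so its product
        with minus infinity is minus infinity.\<close>
      thus ?thesis using elim(2) by (simp add: elog_def)
    next
      case False
      hence "desc_prob n F > 0" using desc_prob_nonneg[of n F] by simp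
      hence "ln (desc_prob n F) \<le> real n * r"
        using elim(1) by (metis exp_le_cancel_iff exp_ln minus_mult_minus)
      thus ?thesis using elim(2) False by (simp add: elog_def field_simps)
    qed
  qed
  hence "limsup (\<lambda>n. ereal (1 / real n) * elog (desc_prob n F)) \<le> ereal r"
    by (rule Limsup_bounded)
  thus False using r(2) by simp
qed

text \<open>It is enough to bound the liminf by the rate at each single point of \<open>G\<close>.
  Where the rate is infinite nothing is to be shown; otherwise both coordinates lie strictly between
  0 and 1, so tilting parameters with these derivatives exist.\<close>

lemma LDP_lower:
  assumes G: "open G"
  shows "- (INF u\<in>G. joint_rate u) \<le> liminf (\<lambda>n. ereal (1 / real n) * elog (desc_prob n G))"
proof -
  let ?l = "liminf (\<lambda>n. ereal (1 / real n) * elog (desc_prob n G))"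
  have "- ?l \<le> joint_rate u" if u: "u \<in> G" for u
  proof -
    obtain x y where xy: "u = (x, y)" by fastforce
    show ?thesis
    proof (cases "rate x = \<infinity> \<or> rate y = \<infinity>")
      case True
      thus ?thesis using rate_nonneg[of x] rate_nonneg[of y] by (auto simp: xy)
    next
      case False
      hence "0 < x" "x < 1" "0 < y" "y < 1" using rate_eq_top[of x] rate_eq_top[of y] by (auto intro: ccontr)
      then obtain s t where s: "(L has_real_derivative x) (at s)" and t: "(L has_real_derivative y) (at t)"
        using L_has_derivative_exists by metis
      have "ereal (L s + L t - s * x - t * y) \<le> ?l"
      proof (rule ccontr)
        assume "\<not> ?thesis"
        hence lt: "?l < ereal (L s + L t - s * x - t * y)" by (simp only: not_le)
        obtain a where a: "?l < ereal a" "a < L s + L t - s * x - t * y"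
          using ereal_dense2[OF lt] by auto
        from desc_prob_ge[OF G u[unfolded xy] s t a(2)] eventually_ge_at_top[of 1]
        have "\<forall>\<^sub>F n in sequentially. ereal a \<le> ereal (1 / real n) * elog (desc_prob n G)"
        proof eventually_elim
          case (elim n)
          have pos: "desc_prob n G > 0" using elim(1) exp_gt_zero by (rule less_le_trans[rotated])
          hence "real n * a \<le> ln (desc_prob n G)"
            using elim(1) by (metis exp_le_cancel_iff exp_ln)
          thus ?case using elim(2) pos by (simp add: elog_def field_simps)
        qed
        hence "ereal a \<le> ?l" by (rule Liminf_bounded)
        thus False using a(1) by simp
      qed
      hence "- ?l \<le> ereal (x * s - L s) + ereal (y * t - L t)"
        by (subst ereal_uminus_le_reorder) (simp add: algebra_simps)
      also have "\<dots> \<le> rate x + rate y" by (intro add_mono rate_ge)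
      finally show ?thesis by (simp add: xy)
    qed
  qed
  hence "- ?l \<le> (INF u\<in>G. joint_rate u)" by (rule INF_greatest)
  thus ?thesis by (subst ereal_uminus_le_reorder)
qed

lemma measure_distr_desc_point:
  fixes P :: "'w measure"
  assumes \<pi>: "\<pi> \<in> measurable P (count_space {\<sigma>. \<sigma> permutes {1..n}})"
    and distr: "distr P (count_space {\<sigma>. \<sigma> permutes {1..n}}) \<pi> =
      uniform_count_measure {\<sigma>. \<sigma> permutes {1..n}}"
    and F: "F \<in> sets borel"
  shows "measure (distr P borel (\<lambda>\<omega>. desc_point n (\<pi> \<omega>))) F = desc_prob n F"
proof -
  let ?S = "{\<sigma>. \<sigma> permutes {1..n}}"
  have fin: "finite ?S" by (simp add: finite_permutations)
  have m: "desc_point n \<in> measurable (count_space ?S) borel" by simp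
  have "distr P borel (\<lambda>\<omega>. desc_point n (\<pi> \<omega>)) = distr (uniform_count_measure ?S) borel (desc_point n)"
    using distr_distr[OF m \<pi>] distr by (simp add: comp_def)
  also have "measure \<dots> F = measure (uniform_count_measure ?S) (desc_point n -` F \<inter> ?S)"
    using F by (subst measure_distr) (auto simp: space_uniform_count_measure measurable_def sets_uniform_count_measure)
  also have "\<dots> = real (card (desc_point n -` F \<inter> ?S)) / real (card ?S)"
    by (rule measure_uniform_count_measure[OF fin]) auto
  also have "card ?S = fact n" by (subst card_permutations[of _ n]) auto
  also have "desc_point n -` F \<inter> ?S = {\<sigma>. \<sigma> permutes {1..n} \<and> desc_point n \<sigma> \<in> F}" by auto
  finally show ?thesis by (simp add: desc_prob_def)
qed

theorem theorem4p1:
  fixes P :: "nat \<Rightarrow> 'w measure"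
    and \<pi> :: "nat \<Rightarrow> 'w \<Rightarrow> (nat \<Rightarrow> nat)"
  assumes "\<And>n. n \<ge> 1 \<Longrightarrow> prob_space (P n)"
    and "\<And>n. n \<ge> 1 \<Longrightarrow> \<pi> n \<in> measurable (P n) (count_space {\<sigma>. \<sigma> permutes {1..n}})"
    and "\<And>n. n \<ge> 1 \<Longrightarrow>
           distr (P n) (count_space {\<sigma>. \<sigma> permutes {1..n}}) (\<pi> n)
             = uniform_count_measure {\<sigma>. \<sigma> permutes {1..n}}"
  shows "good_rate_function (\<lambda>(x, y). rate x + rate y)
       \<and> satisfies_LDP
           (\<lambda>n. distr (P n) borel
              (\<lambda>\<omega>. (real (descents n (\<pi> n \<omega>)) / real n,
                     real (descents n (inv (\<pi> n \<omega>))) / real n)))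
           (\<lambda>n. real n)
           (\<lambda>(x, y). rate x + rate y)"
proof -
  define \<mu> where "\<mu> = (\<lambda>n. distr (P n) borel (\<lambda>\<omega>. desc_point n (\<pi> n \<omega>)))"
  \<comment> \<open>Nothing is known about \<open>P 0\<close>, so the two sequences are compared
    only from 1 on; limsup and liminf do not see the difference.\<close>
  have ev: "\<forall>\<^sub>F n in sequentially. ereal (1 / real n) * elog (measure (\<mu> n) F) =
      ereal (1 / real n) * elog (desc_prob n F)" if "F \<in> sets borel" for F
    using eventually_ge_at_top[of 1]
  proof eventually_elim
    case (elim n)
    show ?case
      using measure_distr_desc_point[OF assms(2)[OF elim] assms(3)[OF elim] that]
      by (simp only: \<mu>_def)
  qed
  have "satisfies_LDP \<mu> (\<lambda>n. real n) joint_rate"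
    unfolding satisfies_LDP_def
  proof (intro conjI allI impI)
    show "filterlim (\<lambda>n. real n) at_top sequentially" by (rule filterlim_real_sequentially)
    show "rate_function joint_rate" using good_joint_rate by (simp add: good_rate_function_def)
    show "limsup (\<lambda>n. ereal (1 / real n) * elog (measure (\<mu> n) F)) \<le> - (INF u\<in>F. joint_rate u)"
      if "closed F" for F
      using LDP_upper[OF that] Limsup_eq[OF ev[of F]] that by simp
    show "- (INF u\<in>G. joint_rate u) \<le> liminf (\<lambda>n. ereal (1 / real n) * elog (measure (\<mu> n) G))"
      if "open G" for G
      using LDP_lower[OF that] Liminf_eq[OF ev[of G]] that by simp
  qed
  thus ?thesis using good_joint_rate by (simp add: \<mu>_def desc_point_def)
qed

end
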